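(* Let $\varphi$ be any state formula of $\mathcal{L}_{\mathrm{HDMAS}}$. Then: (1) $\mathsf{nf}(\varphi)\in\mathcal{L}^0$; (2) $\mathsf{nf}(\varphi)\equiv_{fin}\varphi$; (3) $\mathsf{nf}(\varphi)$ can be computed effectively and its length is bounded above by a linear function of $|\varphi|$.
   Context: HDMAS models: $\mathcal{M}=\langle\mathit{Ag},\mathit{Act}^+,S,d,\delta,\mathit{AP},\lambda\rangle$ with states $S$, actions $\mathit{Act}^+=\{act_1,\dots,act_n,\varepsilon\}$, available actions $d(s)\ni\varepsilon$, and transitions determined by quantifier-free Presburger guards $\delta(s,s')$ over the numbers $x_i$ of agents performing $act_i$ (each count vector over available actions satisfies exactly one outgoing guard); labelling $\lambda$. An abstract joint strategy for $C$ agents assigns to each state a distribution of $C$ agents over the available actions; $\mathcal{M},s,\theta\models\langle\langle t_1,t_2\rangle\rangle\chi$ iff some abstract joint strategy for $\theta(t_1)$ agents ensures that every play from $s$ (successor determined by the sum of the strategy's distribution and an arbitrary distribution of $\theta(t_2)$ further agents over available actions) satisfies $\chi$; $\mathsf{X},\mathsf{G},\mathsf{U}$, Booleans standard; quantifiers over $\mathbb{N}$. $\varphi\equiv_{fin}\psi$: same truth value at every state of every HDMAS with finite state space, under every assignment $\theta:T\to\mathbb{N}$ (fixing numerals). Syntax: terms $T=\{y_1,y_2\}\cup\{z_1,z_2,\dots\}\cup\mathbb{N}$; path formulas $\mathsf{X}\varphi$, $\mathsf{G}\varphi$, $\psi\,\mathsf{U}\,\varphi$; state formulas $\varphi::=\top\mid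 p\mid\neg\varphi\mid\varphi\wedge\varphi\mid\varphi\vee\varphi\mid\langle\langle t_1,t_2\rangle\rangle\chi\mid\mathcal{Q}\varphi$, $t_1\in T\setminus\{y_2\}$, $t_2\in T\setminus\{y_1\}$, with $\mathcal{Q}$ an admissible prefix $\mathsf{Q}y_i$ or $\mathsf{Q}y_i\mathsf{Q}'y_j$ ($\mathsf{Q},\mathsf{Q}'\in\{\forall,\exists\}$, $i\neq j\in\{1,2\}$) and all free occurrences in $\varphi$ of quantified variables in the scope of an even number of negations. Normal form $\mathcal{L}^0$: (NF1) no $\forall y_1$, no $\exists y_2$; (NF2) every subformula $\langle\langle t_1,t_2\rangle\rangle\chi$ with exactly one of $t_1=y_1$, $t_2=y_2$, that occurrence bound, is immediately preceded by $\exists y_1$ resp. $\forall y_2$; (NF3) every $\langle\langle y_1,y_2\rangle\rangle\chi$ with both occurrences bound is immediately preceded by $\forall y_2\exists y_1$ or $\exists y_1\forall y_2$. $\mathsf{pqe}$: identity on $\top,p$; commutes with $\neg,\wedge,\vee,\langle\langle t_1,t_2\rangle\rangle,\mathsf{X},\mathsf{G},\mathsf{U}$; on prefixed formulas: $\forall y_1\langle\langle y_1,t\rangle\rangle\chi\mapsto\langle\langle0,t\rangle\rangle\mathsf{pqe}(\chi)[0/y_1]$; $\exists y_2\langle\langle t,y_2\rangle\rangle\chi\mapsto\langle\langle t,0\rangle\rangle\mathsf{pqe}(\chi)[0/y_2]$; $\forall y_1\exists y_2$ or $\exists y_2\forall y_1$ before $\langle\langle y_1,y_2\rangle\rangle\chi\mapsto\langle\langle0,0\rangle\rangle\mathsf{pqe}(\chi)[0/y_1,0/y_2]$;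 $\forall y_1\forall y_2$ or $\forall y_2\forall y_1$ before $\langle\langle y_1,y_2\rangle\rangle\chi\mapsto\forall y_2\langle\langle0,y_2\rangle\rangle\mathsf{pqe}(\chi)[0/y_1]$; $\exists y_1\exists y_2$ or $\exists y_2\exists y_1$ before $\langle\langle y_1,y_2\rangle\rangle\chi\mapsto\exists y_1\langle\langle y_1,0\rangle\rangle\mathsf{pqe}(\chi)[0/y_2]$; otherwise $\mathcal{Q}\varphi\mapsto\mathcal{Q}\,\mathsf{pqe}(\varphi)$. ($[0/y]$ replaces free occurrences of $y$ by $0$.) $\mathsf{push}(\mathcal{Q},\xi)$ ($\overline{\mathcal{Q}}$ = dualised prefix): identity on $\top,p$; $\neg\psi\mapsto\neg\mathsf{push}(\overline{\mathcal{Q}},\psi)$; distributes over $\wedge,\vee,\mathsf{X},\mathsf{G},\mathsf{U}$. For $\langle\langle t_1,t_2\rangle\rangle\chi$: if $\mathcal{Q}=\mathsf{Q}y_i$ with $t_i=y_i$, or $\mathcal{Q}\in\{\mathsf{Q}y_1\mathsf{Q}'y_2,\mathsf{Q}'y_2\mathsf{Q}y_1\}$ with $t_1=y_1,t_2=y_2$: $\mathcal{Q}\langle\langle t_1,t_2\rangle\rangle\mathsf{push}(\mathcal{Q},\chi)$; if $\mathcal{Q}=\mathsf{Q}y_i$ with $t_i\ne y_i$, or two-quantifier with $t_1\ne y_1,t_2\ne y_2$: $\langle\langle t_1,t_2\rangle\rangle\mathsf{push}(\mathcal{Q},\chi)$; two-quantifier with $t_1=y_1,t_2\ne y_2$: $\mathsf{Q}y_1\langle\langle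 t_1,t_2\rangle\rangle\mathsf{push}(\mathcal{Q},\chi)$; with $t_1\ne y_1,t_2=y_2$: $\mathsf{Q}'y_2\langle\langle t_1,t_2\rangle\rangle\mathsf{push}(\mathcal{Q},\chi)$. For $\mathsf{Q}''y_k\psi$: $\mathcal{Q}=\mathsf{Q}y_k\mapsto\mathsf{push}(\mathsf{Q}''y_k,\psi)$; $\mathcal{Q}=\mathsf{Q}y_i$, $i\ne k\mapsto\mathsf{push}(\mathsf{Q}y_i\mathsf{Q}''y_k,\psi)$; $\mathcal{Q}=\mathsf{Q}y_i\mathsf{Q}'y_j$ with $i=k\mapsto\mathsf{push}(\mathsf{Q}'y_j\mathsf{Q}''y_k,\psi)$, with $j=k\mapsto\mathsf{push}(\mathsf{Q}y_i\mathsf{Q}''y_k,\psi)$. $\mathsf{nf}$: identity on $\top,p$; commutes with $\neg,\wedge,\vee,\langle\langle t_1,t_2\rangle\rangle,\mathsf{X},\mathsf{G},\mathsf{U}$; $\mathsf{nf}(\mathcal{Q}\psi)=\mathsf{pqe}(\mathsf{push}(\mathcal{Q},\mathsf{nf}(\psi)))$. *)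

theory Defs
  imports Main "HOL-Library.Nat_Bijection" "HOL-Library.Sublist"
begin

section \<open>HDMAS models\<close>

text \<open>Quantifier-free Presburger formulas over the action counters \<open>x\<^sub>i\<close>, with values in the
  natural numbers.\<close>

datatype pterm = PZero | POne | PVar nat | PAdd pterm pterm

datatype guard =
    GTrue
  | GEq pterm pterm
  | GLess pterm pterm
  | GNot guard
  | GAnd guard guard
  | GOr guard guard

primrec pterm_val :: "(nat \<Rightarrow> nat) \<Rightarrow> pterm \<Rightarrow> nat" where
  "pterm_val x PZero = 0"
| "pterm_val x POne = 1"
| "pterm_val x (PVar i) = x i"
| "pterm_val x (PAdd t u) = pterm_val x t + pterm_val x u"

primrec guard_sat :: "(nat \<Rightarrow> nat) \<Rightarrow> guard \<Rightarrow> bool" where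
  "guard_sat x GTrue \<longleftrightarrow> True"
| "guard_sat x (GEq t u) \<longleftrightarrow> pterm_val x t = pterm_val x u"
| "guard_sat x (GLess t u) \<longleftrightarrow> pterm_val x t < pterm_val x u"
| "guard_sat x (GNot g) \<longleftrightarrow> \<not> guard_sat x g"
| "guard_sat x (GAnd g h) \<longleftrightarrow> guard_sat x g \<and> guard_sat x h"
| "guard_sat x (GOr g h) \<longleftrightarrow> guard_sat x g \<or> guard_sat x h"

primrec pterm_vars :: "pterm \<Rightarrow> nat set" where
  "pterm_vars PZero = {}"
| "pterm_vars POne = {}"
| "pterm_vars (PVar i) = {i}"
| "pterm_vars (PAdd t u) = pterm_vars t \<union> pterm_vars u"

primrec guard_vars :: "guard \<Rightarrow> nat set" where
  "guard_vars GTrue = {}"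
| "guard_vars (GEq t u) = pterm_vars t \<union> pterm_vars u"
| "guard_vars (GLess t u) = pterm_vars t \<union> pterm_vars u"
| "guard_vars (GNot g) = guard_vars g"
| "guard_vars (GAnd g h) = guard_vars g \<union> guard_vars h"
| "guard_vars (GOr g h) = guard_vars g \<union> guard_vars h"

text \<open>\<open>Idle\<close> is the action \<open>\<epsilon>\<close>.\<close>

datatype action = Act nat | Idle

text \<open>\<open>num_acts\<close> is the number \<open>n\<close> of actions other than \<open>\<epsilon>\<close>. Truth of formulas depends only on
  numbers of agents, so nothing refers to the set \<open>agents\<close> of agent names.\<close>

record 's hdmas =
  agents :: "nat set"
  num_acts :: nat
  states :: "'s set"
  avail :: "'s \<Rightarrow> action set"
  trans_guard :: "'s \<Rightarrow> 's \<Rightarrow> guard"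
  props :: "nat set"
  labels :: "'s \<Rightarrow> nat set"

definition actions :: "'s hdmas \<Rightarrow> action set" where
  "actions M = insert Idle (Act ` {1..num_acts M})"

text \<open>An action profile is abstracted to the vector \<open>c\<close> of the numbers of agents performing each
  action; guards see only the counters of the actions other than \<open>\<epsilon>\<close>.\<close>

definition over_avail :: "'s hdmas \<Rightarrow> 's \<Rightarrow> (action \<Rightarrow> nat) \<Rightarrow> bool" where
  "over_avail M s c \<longleftrightarrow> (\<forall>a. a \<notin> avail M s \<longrightarrow> c a = 0)"

definition enabled :: "'s hdmas \<Rightarrow> 's \<Rightarrow> (action \<Rightarrow> nat) \<Rightarrow> 's \<Rightarrow> bool" where
  "enabled M s c s' \<longleftrightarrow> guard_sat (\<lambda>i. c (Act i)) (trans_guard M s s')"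

definition is_hdmas :: "'s hdmas \<Rightarrow> bool" where
  "is_hdmas M \<longleftrightarrow>
     (\<forall>s \<in> states M. avail M s \<subseteq> actions M \<and> Idle \<in> avail M s) \<and>
     (\<forall>s \<in> states M. \<forall>s' \<in> states M. guard_vars (trans_guard M s s') \<subseteq> {1..num_acts M}) \<and>
     (\<forall>s \<in> states M. \<forall>c. over_avail M s c \<longrightarrow> (\<exists>!s'. s' \<in> states M \<and> enabled M s c s')) \<and>
     (\<forall>s \<in> states M. labels M s \<subseteq> props M)"

definition distribution :: "'s hdmas \<Rightarrow> 's \<Rightarrow> nat \<Rightarrow> (action \<Rightarrow> nat) \<Rightarrow> bool" where
  "distribution M s C c \<longleftrightarrow> over_avail M s c \<and> (\<Sum>a\<in>avail M s. c a) = C"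

definition joint_strategy :: "'s hdmas \<Rightarrow> nat \<Rightarrow> ('s \<Rightarrow> action \<Rightarrow> nat) \<Rightarrow> bool" where
  "joint_strategy M C \<sigma> \<longleftrightarrow> (\<forall>s \<in> states M. distribution M s C (\<sigma> s))"

definition play :: "'s hdmas \<Rightarrow> ('s \<Rightarrow> action \<Rightarrow> nat) \<Rightarrow> nat \<Rightarrow> 's \<Rightarrow> (nat \<Rightarrow> 's) \<Rightarrow> bool" where
  "play M \<sigma> N s \<pi> \<longleftrightarrow>
     \<pi> 0 = s \<and>
     (\<forall>i. \<pi> (Suc i) \<in> states M \<and>
          (\<exists>c. distribution M (\<pi> i) N c \<and>
               enabled M (\<pi> i) (\<lambda>a. \<sigma> (\<pi> i) a + c a) (\<pi> (Suc i))))"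


section \<open>Syntax\<close>

datatype yvar = Y1 | Y2

datatype tm = Y yvar | Z nat | Num nat

datatype quant = Forall | Exists

fun other :: "yvar \<Rightarrow> yvar" where
  "other Y1 = Y2"
| "other Y2 = Y1"

text \<open>\<open>Two q v q'\<close> stands for \<open>q v q' (other v)\<close>, so its two variables are distinct by
  construction.\<close>

datatype qprefix = One quant yvar | Two quant yvar quant

primrec quants :: "qprefix \<Rightarrow> (quant \<times> yvar) list" where
  "quants (One q v) = [(q, v)]"
| "quants (Two q v q') = [(q, v), (q', other v)]"

definition qvars :: "qprefix \<Rightarrow> yvar set" where
  "qvars P = snd ` set (quants P)"

datatype sfm =
    Top
  | Prop nat
  | Neg sfm
  | And sfm sfm
  | Or sfm sfm
  | Strat tm tm pfm
  | Pre qprefix sfm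
and pfm =
    Next sfm
  | Always sfm
  | Until sfm sfm

text \<open>\<open>negs v \<phi>\<close> collects, for every free occurrence of \<open>v\<close> in \<open>\<phi>\<close>, the number of negations of \<open>\<phi>\<close>
  in whose scope it lies.\<close>

primrec negs :: "yvar \<Rightarrow> sfm \<Rightarrow> nat set" and pnegs :: "yvar \<Rightarrow> pfm \<Rightarrow> nat set" where
  "negs v Top = {}"
| "negs v (Prop p) = {}"
| "negs v (Neg \<phi>) = Suc ` negs v \<phi>"
| "negs v (And \<phi> \<psi>) = negs v \<phi> \<union> negs v \<psi>"
| "negs v (Or \<phi> \<psi>) = negs v \<phi> \<union> negs v \<psi>"
| "negs v (Strat t1 t2 \<chi>) = (if t1 = Y v \<or> t2 = Y v then {0} else {}) \<union> pnegs v \<chi>"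
| "negs v (Pre P \<phi>) = (if v \<in> qvars P then {} else negs v \<phi>)"
| "pnegs v (Next \<phi>) = negs v \<phi>"
| "pnegs v (Always \<phi>) = negs v \<phi>"
| "pnegs v (Until \<psi> \<phi>) = negs v \<psi> \<union> negs v \<phi>"

primrec wf_sfm :: "sfm \<Rightarrow> bool" and wf_pfm :: "pfm \<Rightarrow> bool" where
  "wf_sfm Top \<longleftrightarrow> True"
| "wf_sfm (Prop p) \<longleftrightarrow> True"
| "wf_sfm (Neg \<phi>) \<longleftrightarrow> wf_sfm \<phi>"
| "wf_sfm (And \<phi> \<psi>) \<longleftrightarrow> wf_sfm \<phi> \<and> wf_sfm \<psi>"
| "wf_sfm (Or \<phi> \<psi>) \<longleftrightarrow> wf_sfm \<phi> \<and> wf_sfm \<psi>"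
| "wf_sfm (Strat t1 t2 \<chi>) \<longleftrightarrow> t1 \<noteq> Y Y2 \<and> t2 \<noteq> Y Y1 \<and> wf_pfm \<chi>"
| "wf_sfm (Pre P \<phi>) \<longleftrightarrow> wf_sfm \<phi> \<and> (\<forall>v \<in> qvars P. \<forall>n \<in> negs v \<phi>. even n)"
| "wf_pfm (Next \<phi>) \<longleftrightarrow> wf_sfm \<phi>"
| "wf_pfm (Always \<phi>) \<longleftrightarrow> wf_sfm \<phi>"
| "wf_pfm (Until \<psi> \<phi>) \<longleftrightarrow> wf_sfm \<psi> \<and> wf_sfm \<phi>"

definition L_HDMAS :: "sfm set" where
  "L_HDMAS = {\<phi>. wf_sfm \<phi>}"

text \<open>Length as the number of symbols other than brackets and commas; every term and every atomic
  proposition is one symbol, as are each quantifier and its variable.\<close>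

primrec slen :: "sfm \<Rightarrow> nat" and plen :: "pfm \<Rightarrow> nat" where
  "slen Top = 1"
| "slen (Prop p) = 1"
| "slen (Neg \<phi>) = 1 + slen \<phi>"
| "slen (And \<phi> \<psi>) = 1 + slen \<phi> + slen \<psi>"
| "slen (Or \<phi> \<psi>) = 1 + slen \<phi> + slen \<psi>"
| "slen (Strat t1 t2 \<chi>) = 3 + plen \<chi>"
| "slen (Pre P \<phi>) = 2 * length (quants P) + slen \<phi>"
| "plen (Next \<phi>) = 1 + slen \<phi>"
| "plen (Always \<phi>) = 1 + slen \<phi>"
| "plen (Until \<psi> \<phi>) = 1 + slen \<psi> + slen \<phi>"


section \<open>Semantics\<close>

definition assignment :: "(tm \<Rightarrow> nat) \<Rightarrow> bool" where
  "assignment \<theta> \<longleftrightarrow> (\<forall>n. \<theta> (Num n) = n)"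

primrec quantify :: "quant \<Rightarrow> (nat \<Rightarrow> bool) \<Rightarrow> bool" where
  "quantify Forall F \<longleftrightarrow> (\<forall>n. F n)"
| "quantify Exists F \<longleftrightarrow> (\<exists>n. F n)"

primrec sat :: "'s hdmas \<Rightarrow> 's \<Rightarrow> (tm \<Rightarrow> nat) \<Rightarrow> sfm \<Rightarrow> bool"
  and psat :: "'s hdmas \<Rightarrow> (nat \<Rightarrow> 's) \<Rightarrow> (tm \<Rightarrow> nat) \<Rightarrow> pfm \<Rightarrow> bool" where
  "sat M s \<theta> Top \<longleftrightarrow> True"
| "sat M s \<theta> (Prop p) \<longleftrightarrow> p \<in> labels M s"
| "sat M s \<theta> (Neg \<phi>) \<longleftrightarrow> \<not> sat M s \<theta> \<phi>"
| "sat M s \<theta> (And \<phi> \<psi>) \<longleftrightarrow> sat M s \<theta> \<phi> \<and> sat M s \<theta> \<psi>"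
| "sat M s \<theta> (Or \<phi> \<psi>) \<longleftrightarrow> sat M s \<theta> \<phi> \<or> sat M s \<theta> \<psi>"
| "sat M s \<theta> (Strat t1 t2 \<chi>) \<longleftrightarrow>
     (\<exists>\<sigma>. joint_strategy M (\<theta> t1) \<sigma> \<and> (\<forall>\<pi>. play M \<sigma> (\<theta> t2) s \<pi> \<longrightarrow> psat M \<pi> \<theta> \<chi>))"
| "sat M s \<theta> (Pre P \<phi>) \<longleftrightarrow>
     (case P of
        One q v \<Rightarrow> quantify q (\<lambda>k. sat M s (\<theta>(Y v := k)) \<phi>)
      | Two q v q' \<Rightarrow>
          quantify q (\<lambda>k. quantify q' (\<lambda>l. sat M s (\<theta>(Y v := k, Y (other v) := l)) \<phi>)))"
| "psat M \<pi> \<theta> (Next \<phi>) \<longleftrightarrow> sat M (\<pi> 1) \<theta> \<phi>"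
| "psat M \<pi> \<theta> (Always \<phi>) \<longleftrightarrow> (\<forall>i. sat M (\<pi> i) \<theta> \<phi>)"
| "psat M \<pi> \<theta> (Until \<psi> \<phi>) \<longleftrightarrow> (\<exists>i. sat M (\<pi> i) \<theta> \<phi> \<and> (\<forall>j<i. sat M (\<pi> j) \<theta> \<psi>))"

definition fin_equiv :: "'s itself \<Rightarrow> sfm \<Rightarrow> sfm \<Rightarrow> bool" where
  "fin_equiv _ \<phi> \<psi> \<longleftrightarrow>
     (\<forall>(M :: 's hdmas) s \<theta>. is_hdmas M \<and> finite (states M) \<and> s \<in> states M \<and> assignment \<theta> \<longrightarrow>
        (sat M s \<theta> \<phi> \<longleftrightarrow> sat M s \<theta> \<psi>))"


section \<open>Normal form\<close>

primrec all_quants :: "sfm \<Rightarrow> (quant \<times> yvar) set"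
  and pall_quants :: "pfm \<Rightarrow> (quant \<times> yvar) set" where
  "all_quants Top = {}"
| "all_quants (Prop p) = {}"
| "all_quants (Neg \<phi>) = all_quants \<phi>"
| "all_quants (And \<phi> \<psi>) = all_quants \<phi> \<union> all_quants \<psi>"
| "all_quants (Or \<phi> \<psi>) = all_quants \<phi> \<union> all_quants \<psi>"
| "all_quants (Strat t1 t2 \<chi>) = pall_quants \<chi>"
| "all_quants (Pre P \<phi>) = set (quants P) \<union> all_quants \<phi>"
| "pall_quants (Next \<phi>) = all_quants \<phi>"
| "pall_quants (Always \<phi>) = all_quants \<phi>"
| "pall_quants (Until \<psi> \<phi>) = all_quants \<psi> \<union> all_quants \<phi>"

text \<open>\<open>strat_occs B qs \<phi>\<close> collects one entry \<open>(B', qs', t1, t2)\<close> per occurrence of a subformula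
  \<open>Strat t1 t2 \<chi>\<close> in \<open>\<phi>\<close>, where \<open>B'\<close> is the set of variables quantified around it and \<open>qs'\<close> the
  maximal string of quantifiers immediately preceding it; \<open>B\<close> and \<open>qs\<close> describe the context of
  \<open>\<phi>\<close> itself.\<close>

primrec strat_occs ::
    "yvar set \<Rightarrow> (quant \<times> yvar) list \<Rightarrow> sfm \<Rightarrow> (yvar set \<times> (quant \<times> yvar) list \<times> tm \<times> tm) set"
  and pstrat_occs ::
    "yvar set \<Rightarrow> pfm \<Rightarrow> (yvar set \<times> (quant \<times> yvar) list \<times> tm \<times> tm) set" where
  "strat_occs B qs Top = {}"
| "strat_occs B qs (Prop p) = {}"
| "strat_occs B qs (Neg \<phi>) = strat_occs B [] \<phi>"
| "strat_occs B qs (And \<phi> \<psi>) = strat_occs B [] \<phi> \<union> strat_occs B [] \<psi>"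
| "strat_occs B qs (Or \<phi> \<psi>) = strat_occs B [] \<phi> \<union> strat_occs B [] \<psi>"
| "strat_occs B qs (Strat t1 t2 \<chi>) = insert (B, qs, t1, t2) (pstrat_occs B \<chi>)"
| "strat_occs B qs (Pre P \<phi>) = strat_occs (B \<union> qvars P) (qs @ quants P) \<phi>"
| "pstrat_occs B (Next \<phi>) = strat_occs B [] \<phi>"
| "pstrat_occs B (Always \<phi>) = strat_occs B [] \<phi>"
| "pstrat_occs B (Until \<psi> \<phi>) = strat_occs B [] \<psi> \<union> strat_occs B [] \<phi>"

definition NF1 :: "sfm \<Rightarrow> bool" where
  "NF1 \<phi> \<longleftrightarrow> (Forall, Y1) \<notin> all_quants \<phi> \<and> (Exists, Y2) \<notin> all_quants \<phi>"

definition NF2 :: "sfm \<Rightarrow> bool" where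
  "NF2 \<phi> \<longleftrightarrow>
     (\<forall>(B, qs, t1, t2) \<in> strat_occs {} [] \<phi>.
        (t1 = Y Y1 \<and> t2 \<noteq> Y Y2 \<and> Y1 \<in> B \<longrightarrow> suffix [(Exists, Y1)] qs) \<and>
        (t1 \<noteq> Y Y1 \<and> t2 = Y Y2 \<and> Y2 \<in> B \<longrightarrow> suffix [(Forall, Y2)] qs))"

definition NF3 :: "sfm \<Rightarrow> bool" where
  "NF3 \<phi> \<longleftrightarrow>
     (\<forall>(B, qs, t1, t2) \<in> strat_occs {} [] \<phi>.
        t1 = Y Y1 \<and> t2 = Y Y2 \<and> Y1 \<in> B \<and> Y2 \<in> B \<longrightarrow>
          suffix [(Forall, Y2), (Exists, Y1)] qs \<or> suffix [(Exists, Y1), (Forall, Y2)] qs)"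

definition L0 :: "sfm set" where
  "L0 = {\<phi> \<in> L_HDMAS. NF1 \<phi> \<and> NF2 \<phi> \<and> NF3 \<phi>}"


section \<open>Transformation to normal form\<close>

definition tm_zero :: "yvar \<Rightarrow> tm \<Rightarrow> tm" where
  "tm_zero v t = (if t = Y v then Num 0 else t)"

primrec zero :: "yvar \<Rightarrow> sfm \<Rightarrow> sfm" and pzero :: "yvar \<Rightarrow> pfm \<Rightarrow> pfm" where
  "zero v Top = Top"
| "zero v (Prop p) = Prop p"
| "zero v (Neg \<phi>) = Neg (zero v \<phi>)"
| "zero v (And \<phi> \<psi>) = And (zero v \<phi>) (zero v \<psi>)"
| "zero v (Or \<phi> \<psi>) = Or (zero v \<phi>) (zero v \<psi>)"
| "zero v (Strat t1 t2 \<chi>) = Strat (tm_zero v t1) (tm_zero v t2) (pzero v \<chi>)"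
| "zero v (Pre P \<phi>) = Pre P (if v \<in> qvars P then \<phi> else zero v \<phi>)"
| "pzero v (Next \<phi>) = Next (zero v \<phi>)"
| "pzero v (Always \<phi>) = Always (zero v \<phi>)"
| "pzero v (Until \<psi> \<phi>) = Until (zero v \<psi>) (zero v \<phi>)"

text \<open>\<open>elim_prefix P t1 t2 \<chi>\<close> is the result for \<open>P \<langle>\<langle>t1, t2\<rangle>\<rangle> \<chi>'\<close>, where \<open>\<chi>\<close> is the already
  transformed \<open>\<chi>'\<close>; the last equation is the default case.\<close>

fun elim_prefix :: "qprefix \<Rightarrow> tm \<Rightarrow> tm \<Rightarrow> pfm \<Rightarrow> sfm" where
  "elim_prefix (One Forall Y1) (Y Y1) t \<chi> = Strat (Num 0) t (pzero Y1 \<chi>)"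
| "elim_prefix (One Exists Y2) t (Y Y2) \<chi> = Strat t (Num 0) (pzero Y2 \<chi>)"
| "elim_prefix (Two Forall Y1 Exists) (Y Y1) (Y Y2) \<chi> =
     Strat (Num 0) (Num 0) (pzero Y2 (pzero Y1 \<chi>))"
| "elim_prefix (Two Exists Y2 Forall) (Y Y1) (Y Y2) \<chi> =
     Strat (Num 0) (Num 0) (pzero Y2 (pzero Y1 \<chi>))"
| "elim_prefix (Two Forall v Forall) (Y Y1) (Y Y2) \<chi> =
     Pre (One Forall Y2) (Strat (Num 0) (Y Y2) (pzero Y1 \<chi>))"
| "elim_prefix (Two Exists v Exists) (Y Y1) (Y Y2) \<chi> =
     Pre (One Exists Y1) (Strat (Y Y1) (Num 0) (pzero Y2 \<chi>))"
| "elim_prefix P t1 t2 \<chi> = Pre P (Strat t1 t2 \<chi>)"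

fun pqe :: "sfm \<Rightarrow> sfm" and ppqe :: "pfm \<Rightarrow> pfm" where
  "pqe Top = Top"
| "pqe (Prop p) = Prop p"
| "pqe (Neg \<phi>) = Neg (pqe \<phi>)"
| "pqe (And \<phi> \<psi>) = And (pqe \<phi>) (pqe \<psi>)"
| "pqe (Or \<phi> \<psi>) = Or (pqe \<phi>) (pqe \<psi>)"
| "pqe (Strat t1 t2 \<chi>) = Strat t1 t2 (ppqe \<chi>)"
| "pqe (Pre P (Strat t1 t2 \<chi>)) = elim_prefix P t1 t2 (ppqe \<chi>)"
| "pqe (Pre P \<phi>) = Pre P (pqe \<phi>)"
| "ppqe (Next \<phi>) = Next (pqe \<phi>)"
| "ppqe (Always \<phi>) = Always (pqe \<phi>)"
| "ppqe (Until \<psi> \<phi>) = Until (pqe \<psi>) (pqe \<phi>)"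

primrec dual :: "quant \<Rightarrow> quant" where
  "dual Forall = Exists"
| "dual Exists = Forall"

primrec dual_prefix :: "qprefix \<Rightarrow> qprefix" where
  "dual_prefix (One q v) = One (dual q) v"
| "dual_prefix (Two q v q') = Two (dual q) v (dual q')"

text \<open>\<open>absorb Q (q, k)\<close> is the prefix pushed further when \<open>Q\<close> meets the quantifier \<open>q k\<close>.
  In \<open>Two q' i q\<close> below, the second variable is \<open>other i = k\<close>; in \<open>Two q'' (other i) q\<close> it
  is \<open>other (other i) = i = k\<close>.\<close>

fun absorb :: "qprefix \<Rightarrow> quant \<times> yvar \<Rightarrow> qprefix" where
  "absorb (One q' i) (q, k) = (if i = k then One q k else Two q' i q)"
| "absorb (Two q' i q'') (q, k) = (if i = k then Two q'' (other i) q else Two q' i q)"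

definition has_yvar :: "yvar \<Rightarrow> tm \<Rightarrow> tm \<Rightarrow> bool" where
  "has_yvar v t1 t2 \<longleftrightarrow> (case v of Y1 \<Rightarrow> t1 = Y Y1 | Y2 \<Rightarrow> t2 = Y Y2)"

fun place :: "qprefix \<Rightarrow> tm \<Rightarrow> tm \<Rightarrow> pfm \<Rightarrow> sfm" where
  "place (One q i) t1 t2 \<chi> =
     (if has_yvar i t1 t2 then Pre (One q i) (Strat t1 t2 \<chi>) else Strat t1 t2 \<chi>)"
| "place (Two q i q') t1 t2 \<chi> =
     (if has_yvar i t1 t2 \<and> has_yvar (other i) t1 t2 then Pre (Two q i q') (Strat t1 t2 \<chi>)
      else if has_yvar i t1 t2 then Pre (One q i) (Strat t1 t2 \<chi>)
      else if has_yvar (other i) t1 t2 then Pre (One q' (other i)) (Strat t1 t2 \<chi>)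
      else Strat t1 t2 \<chi>)"

text \<open>A two-quantifier prefix \<open>q v q' w\<close> inside the formula is met as \<open>q v\<close> followed by \<open>q' w\<close>.\<close>

primrec push :: "qprefix \<Rightarrow> sfm \<Rightarrow> sfm" and ppush :: "qprefix \<Rightarrow> pfm \<Rightarrow> pfm" where
  "push Q Top = Top"
| "push Q (Prop p) = Prop p"
| "push Q (Neg \<psi>) = Neg (push (dual_prefix Q) \<psi>)"
| "push Q (And \<phi> \<psi>) = And (push Q \<phi>) (push Q \<psi>)"
| "push Q (Or \<phi> \<psi>) = Or (push Q \<phi>) (push Q \<psi>)"
| "push Q (Strat t1 t2 \<chi>) = place Q t1 t2 (ppush Q \<chi>)"
| "push Q (Pre P \<psi>) = push (foldl absorb Q (quants P)) \<psi>"
| "ppush Q (Next \<phi>) = Next (push Q \<phi>)"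
| "ppush Q (Always \<phi>) = Always (push Q \<phi>)"
| "ppush Q (Until \<psi> \<phi>) = Until (push Q \<psi>) (push Q \<phi>)"

primrec nf :: "sfm \<Rightarrow> sfm" and pnf :: "pfm \<Rightarrow> pfm" where
  "nf Top = Top"
| "nf (Prop p) = Prop p"
| "nf (Neg \<phi>) = Neg (nf \<phi>)"
| "nf (And \<phi> \<psi>) = And (nf \<phi>) (nf \<psi>)"
| "nf (Or \<phi> \<psi>) = Or (nf \<phi>) (nf \<psi>)"
| "nf (Strat t1 t2 \<chi>) = Strat t1 t2 (pnf \<chi>)"
| "nf (Pre Q \<psi>) = pqe (push Q (nf \<psi>))"
| "pnf (Next \<phi>) = Next (nf \<phi>)"
| "pnf (Always \<phi>) = Always (nf \<phi>)"
| "pnf (Until \<psi> \<phi>) = Until (nf \<psi>) (nf \<phi>)"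


section \<open>Effective computability\<close>

text \<open>The total recursive functions of arity \<open>k\<close>, acting on argument lists of length \<open>k\<close>;
  minimisation is applied only to regular functions.\<close>

inductive recursive_fn :: "nat \<Rightarrow> (nat list \<Rightarrow> nat) \<Rightarrow> bool" where
  zero: "recursive_fn k (\<lambda>xs. 0)"
| succ: "recursive_fn 1 (\<lambda>xs. Suc (xs ! 0))"
| proj: "i < k \<Longrightarrow> recursive_fn k (\<lambda>xs. xs ! i)"
| comp: "recursive_fn (length fs) g \<Longrightarrow> (\<forall>f \<in> set fs. recursive_fn k f) \<Longrightarrow>
    recursive_fn k (\<lambda>xs. g (map (\<lambda>f. f xs) fs))"
| prec: "recursive_fn k f \<Longrightarrow> recursive_fn (k + 2) g \<Longrightarrow>
    recursive_fn (k + 1) (\<lambda>xs. rec_nat (f (tl xs)) (\<lambda>n r. g (n # r # tl xs)) (hd xs))"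
| mini: "recursive_fn (k + 1) f \<Longrightarrow> (\<forall>xs. length xs = k \<longrightarrow> (\<exists>n. f (n # xs) = 0)) \<Longrightarrow>
    recursive_fn k (\<lambda>xs. LEAST n. f (n # xs) = 0)"

text \<open>Goedel numbering of formulas; the codes of proper subformulas are strictly smaller.\<close>

primrec code_yvar :: "yvar \<Rightarrow> nat" where
  "code_yvar Y1 = 0"
| "code_yvar Y2 = 1"

primrec code_quant :: "quant \<Rightarrow> nat" where
  "code_quant Forall = 0"
| "code_quant Exists = 1"

primrec code_tm :: "tm \<Rightarrow> nat" where
  "code_tm (Y v) = prod_encode (0, code_yvar v)"
| "code_tm (Z k) = prod_encode (1, k)"
| "code_tm (Num n) = prod_encode (2, n)"

primrec code_prefix :: "qprefix \<Rightarrow> nat" where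
  "code_prefix (One q v) = prod_encode (0, prod_encode (code_quant q, code_yvar v))"
| "code_prefix (Two q v q') =
     prod_encode (1, prod_encode (code_quant q, prod_encode (code_yvar v, code_quant q')))"

primrec code_sfm :: "sfm \<Rightarrow> nat" and code_pfm :: "pfm \<Rightarrow> nat" where
  "code_sfm Top = prod_encode (0, 0)"
| "code_sfm (Prop p) = prod_encode (1, p)"
| "code_sfm (Neg \<phi>) = prod_encode (2, code_sfm \<phi>)"
| "code_sfm (And \<phi> \<psi>) = prod_encode (3, prod_encode (code_sfm \<phi>, code_sfm \<psi>))"
| "code_sfm (Or \<phi> \<psi>) = prod_encode (4, prod_encode (code_sfm \<phi>, code_sfm \<psi>))"
| "code_sfm (Strat t1 t2 \<chi>) =
     prod_encode (5, prod_encode (code_tm t1, prod_encode (code_tm t2, code_pfm \<chi>)))"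
| "code_sfm (Pre P \<phi>) = prod_encode (6, prod_encode (code_prefix P, code_sfm \<phi>))"
| "code_pfm (Next \<phi>) = prod_encode (7, code_sfm \<phi>)"
| "code_pfm (Always \<phi>) = prod_encode (8, code_sfm \<phi>)"
| "code_pfm (Until \<psi> \<phi>) = prod_encode (9, prod_encode (code_sfm \<psi>, code_sfm \<phi>))"

definition computable_on :: "sfm set \<Rightarrow> (sfm \<Rightarrow> sfm) \<Rightarrow> bool" where
  "computable_on L f \<longleftrightarrow>
     (\<exists>g. recursive_fn 1 g \<and> (\<forall>\<phi> \<in> L. g [code_sfm \<phi>] = code_sfm (f \<phi>)))"

end

theory Submission
  imports Defs
begin

text \<open>The truth of a formula is monotone in each variable of uniform polarity: coalition agents may
  always idle, and so may opponents, so \<open>\<langle>\<langle>C, N\<rangle>\<rangle>\<chi>\<close> is preserved when \<open>C\<close> grows or \<open>N\<close> shrinks. Over a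
  finite state space, every quantifier over such a variable therefore amounts to evaluation at \<open>0\<close>
  or at all sufficiently large numbers, uniformly for all states and subformulas; evaluation of
  this kind commutes with every connective and with the strategic operator, which justifies
  pushing quantifiers inwards. The quantifiers \<open>\<forall>y\<^sub>1\<close> and \<open>\<exists>y\<^sub>2\<close> in front of a strategic operator are
  those decided at \<open>0\<close>. After pushing, every quantifier stands directly before a strategic
  operator that contains its variables, which gives the normal form conditions and at most four new
  symbols per operator. Computability is course-of-values recursion on Goedel numbers.\<close>

section \<open>Normalisation in one pass\<close>

primrec psubs :: "pfm \<Rightarrow> sfm set" where
  "psubs (Next \<phi>) = {\<phi>}"
| "psubs (Always \<phi>) = {\<phi>}"
| "psubs (Until \<psi> \<phi>) = {\<psi>, \<phi>}"

lemma finite_psubs [simp]: "finite (psubs \<chi>)"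
  by (cases \<chi>) auto

text \<open>A path formula matters only through its immediate state subformulas, so the mutual
  induction reduces to one over state formulas.\<close>

lemma sfm_induct [case_names Top Prop Neg And Or Strat Pre]:
  assumes "P Top" and "\<And>p. P (Prop p)" and "\<And>\<phi>. P \<phi> \<Longrightarrow> P (Neg \<phi>)"
    and "\<And>\<phi> \<psi>. P \<phi> \<Longrightarrow> P \<psi> \<Longrightarrow> P (And \<phi> \<psi>)" and "\<And>\<phi> \<psi>. P \<phi> \<Longrightarrow> P \<psi> \<Longrightarrow> P (Or \<phi> \<psi>)"
    and "\<And>t1 t2 \<chi>. (\<And>\<phi>. \<phi> \<in> psubs \<chi> \<Longrightarrow> P \<phi>) \<Longrightarrow> P (Strat t1 t2 \<chi>)"
    and "\<And>Q \<phi>. P \<phi> \<Longrightarrow> P (Pre Q \<phi>)"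
  shows "P \<phi>"
proof (induction \<phi> rule: sfm.induct[where ?P2.0 = "\<lambda>\<chi>. \<forall>\<phi>\<in>psubs \<chi>. P \<phi>"])
  case (Strat t1 t2 \<chi>)
  then show ?case by (blast intro: assms(6))
qed (simp_all add: assms)

lemma wf_pfm_psubs: "wf_pfm \<chi> \<longleftrightarrow> (\<forall>\<phi>\<in>psubs \<chi>. wf_sfm \<phi>)"
  by (cases \<chi>) auto

lemma pnegs_psubs: "pnegs v \<chi> = (\<Union>\<phi>\<in>psubs \<chi>. negs v \<phi>)"
  by (cases \<chi>) auto

definition vacuous :: "quant \<times> yvar \<Rightarrow> bool" where
  "vacuous qv \<longleftrightarrow> qv = (Forall, Y1) \<or> qv = (Exists, Y2)"

primrec zeroed :: "qprefix \<Rightarrow> yvar \<Rightarrow> bool" where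
  "zeroed (One q i) v \<longleftrightarrow> v = i \<and> vacuous (q, v)"
| "zeroed (Two q i q') v \<longleftrightarrow> (if v = i then vacuous (q, v) else vacuous (q', v))"

text \<open>The predicate \<open>h\<close> marks the variables that occur in the strategic operator.
  One test merges that of \<open>place\<close>, occurrence, with that of \<open>elim_prefix\<close>,
  vacuity.\<close>

fun remaining :: "qprefix \<Rightarrow> (yvar \<Rightarrow> bool) \<Rightarrow> qprefix option" where
  "remaining (One q i) h = (if h i \<and> \<not> vacuous (q, i) then Some (One q i) else None)"
| "remaining (Two q i q') h =
    (let a = h i \<and> \<not> vacuous (q, i); b = h (other i) \<and> \<not> vacuous (q', other i)
     in if a \<and> b then Some (Two q i q') else if a then Some (One q i)
        else if b then Some (One q' (other i)) else None)"

definition zero_if :: "qprefix \<Rightarrow> yvar \<Rightarrow> tm \<Rightarrow> tm" where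
  "zero_if Q v t = (if zeroed Q v then tm_zero v t else t)"

text \<open>The result of \<open>place\<close> followed by \<open>elim_prefix\<close>: a vacuous quantifier is one whose optimal
  value is \<open>0\<close> by monotonicity. Substituting \<open>0\<close> in \<open>\<chi>\<close> is omitted, since after \<open>push\<close> the
  variables of \<open>Q\<close> are no longer free there.\<close>

definition place_elim :: "qprefix \<Rightarrow> tm \<Rightarrow> tm \<Rightarrow> pfm \<Rightarrow> sfm" where
  "place_elim Q t1 t2 \<chi> =
    (let \<phi> = Strat (zero_if Q Y1 t1) (zero_if Q Y2 t2) \<chi>
     in case remaining Q (\<lambda>v. has_yvar v t1 t2) of None \<Rightarrow> \<phi> | Some P \<Rightarrow> Pre P \<phi>)"

text \<open>\<open>pqe\<close> after \<open>push\<close>, fused into one structural recursion; the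
  agreement is \<open>pqe_push\<close>. This form suits both induction and recursion on
  codes.\<close>

primrec np :: "qprefix \<Rightarrow> sfm \<Rightarrow> sfm" and pnp :: "qprefix \<Rightarrow> pfm \<Rightarrow> pfm" where
  "np Q Top = Top"
| "np Q (Prop p) = Prop p"
| "np Q (Neg \<psi>) = Neg (np (dual_prefix Q) \<psi>)"
| "np Q (And \<phi> \<psi>) = And (np Q \<phi>) (np Q \<psi>)"
| "np Q (Or \<phi> \<psi>) = Or (np Q \<phi>) (np Q \<psi>)"
| "np Q (Strat t1 t2 \<chi>) = place_elim Q t1 t2 (pnp Q \<chi>)"
| "np Q (Pre P \<psi>) = np (foldl absorb Q (quants P)) \<psi>"
| "pnp Q (Next \<phi>) = Next (np Q \<phi>)"
| "pnp Q (Always \<phi>) = Always (np Q \<phi>)"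
| "pnp Q (Until \<psi> \<phi>) = Until (np Q \<psi>) (np Q \<phi>)"

lemma psubs_pnp [simp]: "psubs (pnp Q \<chi>) = np Q ` psubs \<chi>"
  by (cases \<chi>) auto

lemma psubs_pnf [simp]: "psubs (pnf \<chi>) = nf ` psubs \<chi>"
  by (cases \<chi>) auto

lemma other_neq [simp]: "other v \<noteq> v" "v \<noteq> other v"
  by (cases v; simp)+

lemma other_other [simp]: "other (other v) = v"
  by (cases v) auto

lemma UNIV_yvar: "UNIV = {v, other v}"
proof -
  have "w \<in> {v, other v}" for w by (cases v; cases w) auto
  then show ?thesis by blast
qed

lemma qvars_simps [simp]: "qvars (One q v) = {v}" "qvars (Two q v q') = UNIV"
  by (auto simp: qvars_def UNIV_yvar[of v])

lemma qvars_dual [simp]: "qvars (dual_prefix Q) = qvars Q"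
  by (cases Q) auto

lemma qvars_absorb [simp]: "qvars (absorb Q (q, k)) = insert k (qvars Q)"
proof (cases Q)
  case (One q' i)
  then show ?thesis using UNIV_yvar[of i] by (cases i; cases k) auto
qed auto

lemma qvars_foldl_absorb: "qvars (foldl absorb Q qs) = snd ` set qs \<union> qvars Q"
  by (induction qs arbitrary: Q) auto

lemma qvars_absorb_prefix [simp]: "qvars (foldl absorb Q (quants P)) = qvars P \<union> qvars Q"
  by (simp add: qvars_foldl_absorb qvars_def[of P])

lemma remaining_SomeD:
  assumes "remaining Q h = Some P" and "v \<in> qvars P"
  shows "v \<in> qvars Q \<and> h v \<and> \<not> zeroed Q v"
proof (cases Q)
  case (One q i)
  with assms show ?thesis by (auto split: if_splits)
next
  case (Two q i q')
  with assms show ?thesis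
    by (cases i; cases v) (auto simp: Let_def split: if_splits)
qed

lemma remaining_cover:
  assumes "v \<in> qvars Q" "h v" "\<not> zeroed Q v"
  shows "\<exists>P. remaining Q h = Some P \<and> v \<in> qvars P"
proof (cases Q)
  case (One q i)
  with assms show ?thesis by auto
next
  case (Two q i q')
  with assms show ?thesis by (cases i; cases v) (auto simp: Let_def)
qed

text \<open>The prefixes that the normal form allows: \<open>y1\<close> only existential,
  \<open>y2\<close> only universal, in either order.\<close>

definition good_prefix :: "qprefix \<Rightarrow> bool" where
  "good_prefix P \<longleftrightarrow>
    P \<in> {One Exists Y1, One Forall Y2, Two Exists Y1 Forall, Two Forall Y2 Exists}"

lemma good_prefix_alt: "good_prefix P \<longleftrightarrow> (\<forall>x\<in>set (quants P). \<not> vacuous x)"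
proof (cases P)
  case (One q v)
  then show ?thesis by (cases q; cases v) (auto simp: good_prefix_def vacuous_def)
next
  case (Two q v q')
  then show ?thesis by (cases q; cases v; cases q') (auto simp: good_prefix_def vacuous_def)
qed

lemma remaining_good: "remaining Q h = Some P \<Longrightarrow> good_prefix P"
  by (cases Q) (auto simp: good_prefix_alt Let_def split: if_splits)

section \<open>Formulas in normal form\<close>

text \<open>Strictly stronger than membership in \<open>L0\<close>, so as to be provable
  inductively: a prefix stands directly before an operator in which all its variables occur, and
  none of them is free further inside.\<close>

inductive normal :: "sfm \<Rightarrow> bool" where
  normal_Top: "normal Top"
| normal_Prop: "normal (Prop p)"
| normal_Neg: "normal \<phi> \<Longrightarrow> normal (Neg \<phi>)"
| normal_And: "normal \<phi> \<Longrightarrow> normal \<psi> \<Longrightarrow> normal (And \<phi> \<psi>)"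
| normal_Or: "normal \<phi> \<Longrightarrow> normal \<psi> \<Longrightarrow> normal (Or \<phi> \<psi>)"
| normal_Strat: "t1 \<noteq> Y Y2 \<Longrightarrow> t2 \<noteq> Y Y1 \<Longrightarrow> (\<And>\<phi>. \<phi> \<in> psubs \<chi> \<Longrightarrow> normal \<phi>) \<Longrightarrow>
    normal (Strat t1 t2 \<chi>)"
| normal_Pre: "t1 \<noteq> Y Y2 \<Longrightarrow> t2 \<noteq> Y Y1 \<Longrightarrow> (\<And>\<phi>. \<phi> \<in> psubs \<chi> \<Longrightarrow> normal \<phi>) \<Longrightarrow>
    good_prefix P \<Longrightarrow> (\<And>v. v \<in> qvars P \<Longrightarrow> has_yvar v t1 t2) \<Longrightarrow>
    (\<And>v. v \<in> qvars P \<Longrightarrow> pnegs v \<chi> = {}) \<Longrightarrow> normal (Pre P (Strat t1 t2 \<chi>))"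

lemma has_yvar_iff:
  "t1 \<noteq> Y Y2 \<Longrightarrow> t2 \<noteq> Y Y1 \<Longrightarrow> has_yvar v t1 t2 \<longleftrightarrow> t1 = Y v \<or> t2 = Y v"
  by (cases v) (auto simp: has_yvar_def)

lemma zero_if_eq_Y: "zero_if Q v t = Y w \<longleftrightarrow> t = Y w \<and> (w = v \<longrightarrow> \<not> zeroed Q v)"
  by (auto simp: zero_if_def tm_zero_def)

lemma has_yvar_zero_if:
  "has_yvar v (zero_if Q Y1 t1) (zero_if Q Y2 t2) \<longleftrightarrow> has_yvar v t1 t2 \<and> \<not> zeroed Q v"
  by (cases v) (auto simp: has_yvar_def zero_if_eq_Y)

lemma normal_place_elim:
  assumes "t1 \<noteq> Y Y2" "t2 \<noteq> Y Y1" "\<And>\<phi>. \<phi> \<in> psubs \<chi> \<Longrightarrow> normal \<phi>"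
    and "\<And>v. v \<in> qvars Q \<Longrightarrow> pnegs v \<chi> = {}"
  shows "normal (place_elim Q t1 t2 \<chi>)"
proof (cases "remaining Q (\<lambda>v. has_yvar v t1 t2)")
  case None
  then show ?thesis
    using assms by (auto simp: place_elim_def zero_if_eq_Y intro!: normal_Strat)
next
  case (Some P)
  have "normal (Pre P (Strat (zero_if Q Y1 t1) (zero_if Q Y2 t2) \<chi>))"
  proof (rule normal_Pre)
    fix v assume v: "v \<in> qvars P"
    show "has_yvar v (zero_if Q Y1 t1) (zero_if Q Y2 t2)"
      using remaining_SomeD[OF Some v] by (simp add: has_yvar_zero_if)
    show "pnegs v \<chi> = {}"
      using assms(4) remaining_SomeD[OF Some v] by simp
  qed (use assms Some in \<open>auto simp: zero_if_eq_Y remaining_good\<close>)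
  with Some show ?thesis by (simp add: place_elim_def)
qed

text \<open>An occurrence of a variable of \<open>Q\<close> in the operator's terms is either
  replaced by \<open>0\<close> or bound by the surviving prefix.\<close>

lemma negs_place_elim:
  assumes "t1 \<noteq> Y Y2" "t2 \<noteq> Y Y1"
  shows "negs v (place_elim Q t1 t2 \<chi>) \<subseteq>
    (if v \<in> qvars Q then {} else if has_yvar v t1 t2 then {0} else {}) \<union> pnegs v \<chi>"
proof -
  let ?h = "\<lambda>v. has_yvar v t1 t2"
  have n: "zero_if Q Y1 t1 \<noteq> Y Y2" "zero_if Q Y2 t2 \<noteq> Y Y1"
    using assms by (auto simp: zero_if_eq_Y)
  have *: "negs v (Strat (zero_if Q Y1 t1) (zero_if Q Y2 t2) \<chi>) =
      (if ?h v \<and> \<not> zeroed Q v then {0} else {}) \<union> pnegs v \<chi>"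
    using has_yvar_iff[OF n, of v] by (auto simp: has_yvar_zero_if)
  show ?thesis
  proof (cases "remaining Q ?h")
    case None
    then show ?thesis
      using remaining_cover[of v Q ?h] * by (auto simp: place_elim_def simp del: negs.simps)
  next
    case (Some P)
    then show ?thesis
      using remaining_cover[of v Q ?h] *
      by (auto simp: place_elim_def)
  qed
qed

text \<open>Quantifiers move, terms do not: a remaining free occurrence keeps its number of
  enclosing negations.\<close>

lemma negs_np:
  "wf_sfm \<phi> \<Longrightarrow> negs v (np Q \<phi>) \<subseteq> (if v \<in> qvars Q then {} else negs v \<phi>)"
proof (induction \<phi> arbitrary: Q rule: sfm_induct)
  case (Neg \<phi>)
  then show ?case using Neg.IH[of "dual_prefix Q"] by (auto split: if_splits)
next
  case (And \<phi> \<psi>)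
  then have "negs v (np Q \<phi>) \<subseteq> (if v \<in> qvars Q then {} else negs v \<phi>)"
    "negs v (np Q \<psi>) \<subseteq> (if v \<in> qvars Q then {} else negs v \<psi>)" by simp_all
  then show ?case by (auto split: if_splits)
next
  case (Or \<phi> \<psi>)
  then have "negs v (np Q \<phi>) \<subseteq> (if v \<in> qvars Q then {} else negs v \<phi>)"
    "negs v (np Q \<psi>) \<subseteq> (if v \<in> qvars Q then {} else negs v \<psi>)" by simp_all
  then show ?case by (auto split: if_splits)
next
  case (Strat t1 t2 \<chi>)
  then have wf: "t1 \<noteq> Y Y2" "t2 \<noteq> Y Y1" "\<And>\<phi>. \<phi> \<in> psubs \<chi> \<Longrightarrow> wf_sfm \<phi>"
    by (auto simp: wf_pfm_psubs)
  have "pnegs v (pnp Q \<chi>) \<subseteq> (if v \<in> qvars Q then {} else pnegs v \<chi>)"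
    using Strat.IH[OF _ wf(3), of _ Q] by (fastforce simp: pnegs_psubs split: if_splits)
  then show ?case
    using negs_place_elim[OF wf(1,2), of v Q "pnp Q \<chi>"] has_yvar_iff[OF wf(1,2), of v]
    by (auto split: if_splits)
next
  case (Pre P \<phi>)
  then show ?case using Pre.IH[of "foldl absorb Q (quants P)"] by (auto split: if_splits)
qed auto

lemma pnegs_pnp: "wf_pfm \<chi> \<Longrightarrow> v \<in> qvars Q \<Longrightarrow> pnegs v (pnp Q \<chi>) = {}"
  using negs_np by (fastforce simp: pnegs_psubs wf_pfm_psubs)

lemma normal_np: "wf_sfm \<phi> \<Longrightarrow> normal (np Q \<phi>)"
proof (induction \<phi> arbitrary: Q rule: sfm_induct)
  case (Strat t1 t2 \<chi>)
  then show ?case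
    by (auto intro!: normal_place_elim simp: pnegs_pnp wf_pfm_psubs)
qed (auto intro: normal.intros)

lemma has_yvar_negs: "has_yvar v t1 t2 \<Longrightarrow> 0 \<in> negs v (Strat t1 t2 \<chi>)"
  by (cases v) (auto simp: has_yvar_def)

lemma normal_wf: "normal \<phi> \<Longrightarrow> wf_sfm \<phi>"
  by (induction rule: normal.induct) (auto simp: wf_pfm_psubs)

section \<open>Agreement of the one-pass form with elimination after pushing\<close>

lemma tm_cases [case_names Y1 Y2 Z Num]:
  obtains "t = Y Y1" | "t = Y Y2" | n where "t = Z n" | n where "t = Num n"
  by (metis tm.exhaust yvar.exhaust)

text \<open>A finite check over prefixes and shapes of terms. The first assumption turns the
  substitutions of \<open>elim_prefix\<close> in \<open>\<chi>\<close> into identities.\<close>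

lemma elim_place_elim:
  assumes "\<And>v. v \<in> qvars Q \<Longrightarrow> pzero v (ppqe \<chi>) = ppqe \<chi>" "t1 \<noteq> Y Y2" "t2 \<noteq> Y Y1"
  shows "pqe (place Q t1 t2 \<chi>) = place_elim Q t1 t2 (ppqe \<chi>)"
proof (cases Q)
  case (One q v)
  show ?thesis
    by (cases q; cases v; cases t1 rule: tm_cases; cases t2 rule: tm_cases)
      (use One assms in \<open>simp_all add: place_elim_def has_yvar_def zero_if_def tm_zero_def vacuous_def\<close>)
next
  case (Two q v q')
  show ?thesis
    by (cases q; cases v; cases q'; cases t1 rule: tm_cases; cases t2 rule: tm_cases)
      (use Two assms in \<open>simp_all add: place_elim_def has_yvar_def zero_if_def tm_zero_def vacuous_def\<close>)
qed

lemma zero_closed: "negs v \<phi> = {} \<Longrightarrow> zero v \<phi> = \<phi>"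
  and pzero_closed: "pnegs v \<chi> = {} \<Longrightarrow> pzero v \<chi> = \<chi>"
  by (induction \<phi> and \<chi>) (auto simp: tm_zero_def split: if_splits)

text \<open>Once pushed, the variables of \<open>Q\<close> are no longer free below the strategic
  operators (\<open>pnegs_pnp\<close>), so substituting \<open>0\<close> there changes
  nothing.\<close>

lemma pqe_push: "wf_sfm \<phi> \<Longrightarrow> pqe (push Q \<phi>) = np Q \<phi>"
proof (induction \<phi> arbitrary: Q rule: sfm_induct)
  case (Strat t1 t2 \<chi>)
  have "ppqe (ppush Q \<chi>) = pnp Q \<chi>"
    using Strat by (cases \<chi>) auto
  then show ?case
    using Strat.prems by (auto simp: elim_place_elim pzero_closed pnegs_pnp)
qed auto

text \<open>The bound on \<open>negs\<close> carries the evenness condition of a prefix over to its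
  normalised scope, for use in \<open>sat_nf\<close>.\<close>

lemma nf_props: "wf_sfm \<phi> \<Longrightarrow> normal (nf \<phi>) \<and> (\<forall>v. negs v (nf \<phi>) \<subseteq> negs v \<phi>)"
proof (induction \<phi> rule: sfm_induct)
  case (Strat t1 t2 \<chi>)
  then have "\<And>\<phi>. \<phi> \<in> psubs \<chi> \<Longrightarrow> normal (nf \<phi>) \<and> (\<forall>v. negs v (nf \<phi>) \<subseteq> negs v \<phi>)"
    by (auto simp: wf_pfm_psubs)
  then show ?case
    using Strat.prems by (fastforce simp: pnegs_psubs intro!: normal_Strat)
next
  case (Pre P \<phi>)
  then have "normal (nf \<phi>)" and sub: "\<And>v. negs v (nf \<phi>) \<subseteq> negs v \<phi>"
    by auto
  then have wf: "wf_sfm (nf \<phi>)"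
    by (simp add: normal_wf)
  have "negs v (np P (nf \<phi>)) \<subseteq> negs v (Pre P \<phi>)" for v
    using negs_np[OF wf, of v P] sub[of v] by (auto split: if_splits)
  then show ?case
    using normal_np[OF wf] by (simp add: pqe_push[OF wf])
next
  case (Neg \<phi>)
  then show ?case by (force intro: normal.intros)
next
  case (And \<phi> \<psi>)
  then show ?case by (force intro: normal.intros)
next
  case (Or \<phi> \<psi>)
  then show ?case by (force intro: normal.intros)
qed (auto intro: normal.intros)

lemma nf_Pre: "wf_sfm \<psi> \<Longrightarrow> nf (Pre Q \<psi>) = np Q (nf \<psi>)"
  by (simp add: nf_props normal_wf pqe_push)

section \<open>From \<open>normal\<close> to the three normal form conditions\<close>

lemma pall_quants_psubs: "pall_quants \<chi> = (\<Union>\<phi>\<in>psubs \<chi>. all_quants \<phi>)"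
  by (cases \<chi>) auto

lemma pstrat_occs_psubs: "pstrat_occs B \<chi> = (\<Union>\<phi>\<in>psubs \<chi>. strat_occs B [] \<phi>)"
  by (cases \<chi>) auto

lemma normal_NF1: "normal \<phi> \<Longrightarrow> NF1 \<phi>"
proof (induction rule: normal.induct)
  case (normal_Pre t1 t2 \<chi> P)
  then have "(Forall, Y1) \<notin> set (quants P)" "(Exists, Y2) \<notin> set (quants P)"
    by (auto simp: good_prefix_alt vacuous_def)
  with normal_Pre.IH show ?case by (simp add: NF1_def pall_quants_psubs)
qed (simp_all add: NF1_def pall_quants_psubs)

text \<open>One condition behind both NF2 and NF3: \<open>P\<close> accounts for all bound variables
  of the operator and binds only variables that occur, which fixes its shape.\<close>

definition good_occ ::
    "yvar set \<Rightarrow> (quant \<times> yvar) list \<Rightarrow> tm \<Rightarrow> tm \<Rightarrow> bool" where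
  "good_occ B qs t1 t2 \<longleftrightarrow>
    (\<forall>v\<in>B. \<not> has_yvar v t1 t2) \<or>
    (\<exists>P. good_prefix P \<and> suffix (quants P) qs \<and> (\<forall>v\<in>B. has_yvar v t1 t2 \<longrightarrow> v \<in> qvars P) \<and>
      (\<forall>v\<in>qvars P. has_yvar v t1 t2))"

text \<open>\<open>B\<close> generalises over the quantifiers outside. That its variables are not
  free persists inwards, because the variables of a normal prefix are not free in the path formula
  below.\<close>

lemma normal_occs:
  assumes "normal \<phi>" and "\<forall>v\<in>B. negs v \<phi> = {}"
  shows "\<forall>(B', qs', t1, t2) \<in> strat_occs B qs \<phi>. good_occ B' qs' t1 t2"
  using assms
proof (induction arbitrary: B qs rule: normal.induct)
  case (normal_Strat t1 t2 \<chi>)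
  have "\<not> has_yvar v t1 t2" if "v \<in> B" for v
    using normal_Strat.prems that has_yvar_negs[of v t1 t2 \<chi>] by blast
  then have "good_occ B qs t1 t2"
    by (simp add: good_occ_def)
  moreover have "\<forall>(B', qs', t1, t2) \<in> strat_occs B [] \<phi>. good_occ B' qs' t1 t2"
    if "\<phi> \<in> psubs \<chi>" for \<phi>
    using normal_Strat.IH[OF that, of B] normal_Strat.prems that by (simp add: pnegs_psubs)
  ultimately show ?case
    by (simp add: pstrat_occs_psubs)
next
  case (normal_Pre t1 t2 \<chi> P)
  have "good_occ (B \<union> qvars P) (qs @ quants P) t1 t2"
    unfolding good_occ_def
  proof (intro disjI2 exI[of _ P] conjI ballI impI)
    fix v assume "v \<in> B \<union> qvars P" "has_yvar v t1 t2"
    then show "v \<in> qvars P"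
      using normal_Pre.prems has_yvar_negs[of v t1 t2 \<chi>] by (auto split: if_splits)
  qed (use normal_Pre.hyps in \<open>auto simp: suffix_def\<close>)
  moreover have "\<forall>(B', qs', t1, t2) \<in> strat_occs (B \<union> qvars P) [] \<phi>. good_occ B' qs' t1 t2"
    if "\<phi> \<in> psubs \<chi>" for \<phi>
  proof -
    \<comment> \<open>A variable of \<open>B\<close> is either not free below the prefix or bound
      again by \<open>P\<close>; both exclude it from \<open>\<chi>\<close>.\<close>
    have "\<forall>v \<in> B \<union> qvars P. negs v \<phi> = {}"
      using normal_Pre.prems normal_Pre.hyps that by (fastforce simp: pnegs_psubs split: if_splits)
    then show ?thesis
      by (rule normal_Pre.IH[OF that])
  qed
  ultimately show ?case
    by (simp add: pstrat_occs_psubs)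
next
  case (normal_Neg \<phi>)
  then show ?case by simp
next
  case (normal_And \<phi> \<psi>)
  then have "\<forall>v\<in>B. negs v \<phi> = {}" "\<forall>v\<in>B. negs v \<psi> = {}"
    by simp_all
  then show ?case
    using normal_And.IH(1)[of B "[]"] normal_And.IH(2)[of B "[]"] by (simp add: ball_Un)
next
  case (normal_Or \<phi> \<psi>)
  then have "\<forall>v\<in>B. negs v \<phi> = {}" "\<forall>v\<in>B. negs v \<psi> = {}"
    by simp_all
  then show ?case
    using normal_Or.IH(1)[of B "[]"] normal_Or.IH(2)[of B "[]"] by (simp add: ball_Un)
qed simp_all

lemma has_yvar_simps [simp]:
  "has_yvar Y1 t1 t2 \<longleftrightarrow> t1 = Y Y1" "has_yvar Y2 t1 t2 \<longleftrightarrow> t2 = Y Y2"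
  by (simp_all add: has_yvar_def)

lemma good_occD:
  assumes "good_occ B qs t1 t2" and "v \<in> B" and "has_yvar v t1 t2"
  shows "\<exists>P. good_prefix P \<and> suffix (quants P) qs \<and>
    (\<forall>w. (w \<in> B \<and> has_yvar w t1 t2 \<longrightarrow> w \<in> qvars P) \<and> (w \<in> qvars P \<longrightarrow> has_yvar w t1 t2))"
  using assms unfolding good_occ_def by blast

text \<open>A prefix that binds \<open>v\<close> but not the other variable has length one, and
  goodness fixes its quantifier.\<close>

lemma good_occ_single:
  assumes "good_occ B qs t1 t2" "v \<in> B" "has_yvar v t1 t2" "\<not> has_yvar (other v) t1 t2"
  shows "suffix [(if v = Y1 then Exists else Forall, v)] qs"
proof -
  obtain P where P: "good_prefix P" "suffix (quants P) qs" "v \<in> qvars P" "other v \<notin> qvars P"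
    using good_occD[OF assms(1-3)] assms by blast
  then have "quants P = [(if v = Y1 then Exists else Forall, v)]"
    by (cases v) (auto simp: good_prefix_def)
  with P(2) show ?thesis by simp
qed

lemma good_occ_both:
  assumes "good_occ B qs (Y Y1) (Y Y2)" "Y1 \<in> B" "Y2 \<in> B"
  shows "suffix [(Forall, Y2), (Exists, Y1)] qs \<or> suffix [(Exists, Y1), (Forall, Y2)] qs"
proof -
  obtain P where P: "good_prefix P" "suffix (quants P) qs" "Y1 \<in> qvars P" "Y2 \<in> qvars P"
    using good_occD[OF assms(1,2)] assms by auto
  then have "quants P = [(Forall, Y2), (Exists, Y1)] \<or> quants P = [(Exists, Y1), (Forall, Y2)]"
    by (auto simp: good_prefix_def)
  with P(2) show ?thesis by auto
qed

lemma normal_L0: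
  assumes "normal \<phi>" shows "\<phi> \<in> L0"
proof -
  have occ: "good_occ B qs t1 t2" if "(B, qs, t1, t2) \<in> strat_occs {} [] \<phi>" for B qs t1 t2
    using normal_occs[OF assms, of "{}" "[]"] that by auto
  have "suffix [(Exists, Y1)] qs"
    if "(B, qs, Y Y1, t2) \<in> strat_occs {} [] \<phi>" "t2 \<noteq> Y Y2" "Y1 \<in> B" for B qs t2
    using good_occ_single[OF occ[OF that(1)], of Y1] that by simp
  moreover have "suffix [(Forall, Y2)] qs"
    if "(B, qs, t1, Y Y2) \<in> strat_occs {} [] \<phi>" "t1 \<noteq> Y Y1" "Y2 \<in> B" for B qs t1
    using good_occ_single[OF occ[OF that(1)], of Y2] that by simp
  ultimately have "NF2 \<phi>"
    unfolding NF2_def by auto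
  moreover have "suffix [(Forall, Y2), (Exists, Y1)] qs \<or> suffix [(Exists, Y1), (Forall, Y2)] qs"
    if "(B, qs, Y Y1, Y Y2) \<in> strat_occs {} [] \<phi>" "Y1 \<in> B" "Y2 \<in> B" for B qs
    using good_occ_both[OF occ[OF that(1)]] that by simp
  then have "NF3 \<phi>"
    unfolding NF3_def by auto
  ultimately show ?thesis
    using assms by (simp add: L0_def L_HDMAS_def normal_NF1 normal_wf)
qed

section \<open>Linear length bound\<close>

text \<open>The length without quantifiers, which no transformation changes.\<close>

primrec core :: "sfm \<Rightarrow> nat" and pcore :: "pfm \<Rightarrow> nat" where
  "core Top = 1"
| "core (Prop p) = 1"
| "core (Neg \<phi>) = 1 + core \<phi>"
| "core (And \<phi> \<psi>) = 1 + core \<phi> + core \<psi>"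
| "core (Or \<phi> \<psi>) = 1 + core \<phi> + core \<psi>"
| "core (Strat t1 t2 \<chi>) = 3 + pcore \<chi>"
| "core (Pre P \<phi>) = core \<phi>"
| "pcore (Next \<phi>) = 1 + core \<phi>"
| "pcore (Always \<phi>) = 1 + core \<phi>"
| "pcore (Until \<psi> \<phi>) = 1 + core \<psi> + core \<phi>"

lemma core_le_slen: "core \<phi> \<le> slen \<phi>" and "pcore \<chi> \<le> plen \<chi>"
  by (induction \<phi> and \<chi>) auto

lemma core_np: "core (np Q \<phi>) = core \<phi>" and "pcore (pnp Q \<chi>) = pcore \<chi>"
  by (induction \<phi> and \<chi> arbitrary: Q and Q)
    (auto simp: place_elim_def Let_def split: option.splits)

lemma core_nf: "wf_sfm \<phi> \<Longrightarrow> core (nf \<phi>) = core \<phi>"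
  and "wf_pfm \<chi> \<Longrightarrow> pcore (pnf \<chi>) = pcore \<chi>"
  by (induction \<phi> and \<chi>) (auto simp: nf_Pre core_np simp del: nf.simps(7))

lemma plen_le: "(\<forall>\<phi>\<in>psubs \<chi>. slen \<phi> \<le> 3 * core \<phi>) \<Longrightarrow> plen \<chi> \<le> 3 * pcore \<chi>"
  by (cases \<chi>) auto

text \<open>A prefix costs at most four symbols and precedes an operator with three of its own, so
  seven symbols are charged to three of the core.\<close>

lemma slen_normal: "normal \<phi> \<Longrightarrow> slen \<phi> \<le> 3 * core \<phi>"
proof (induction rule: normal.induct)
  case (normal_Strat t1 t2 \<chi>)
  then have "plen \<chi> \<le> 3 * pcore \<chi>" by (simp add: plen_le)
  then show ?case by simp
next
  case (normal_Pre t1 t2 \<chi> P)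
  then have "plen \<chi> \<le> 3 * pcore \<chi>" by (simp add: plen_le)
  moreover have "length (quants P) \<le> 2" by (cases P) auto
  ultimately show ?case by simp
qed auto

lemma slen_nf: "wf_sfm \<phi> \<Longrightarrow> slen (nf \<phi>) \<le> 3 * slen \<phi>"
  using slen_normal[of "nf \<phi>"] nf_props[of \<phi>] core_nf[of \<phi>] core_le_slen[of \<phi>] by simp

section \<open>Monotonicity in the numbers of agents\<close>

text \<open>\<open>d\<close> is \<open>True\<close> for upward and \<open>False\<close> for downward
  monotone; a flag can be flipped by negation and computed from the polarity.\<close>

definition directed :: "bool \<Rightarrow> (nat \<Rightarrow> bool) \<Rightarrow> bool" where
  "directed d f \<longleftrightarrow> (\<forall>k l. k \<le> l \<longrightarrow> (if d then f k \<longrightarrow> f l else f l \<longrightarrow> f k))"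

definition directed_in :: "yvar \<Rightarrow> bool \<Rightarrow> ((tm \<Rightarrow> nat) \<Rightarrow> bool) \<Rightarrow> bool" where
  "directed_in v d F \<longleftrightarrow> (\<forall>\<theta>. directed d (\<lambda>k. F (\<theta>(Y v := k))))"

lemma directed_const [simp]: "directed d (\<lambda>k. c)"
  by (simp add: directed_def)

lemma directed_not: "directed d (\<lambda>k. \<not> f k) \<longleftrightarrow> directed (\<not> d) f"
  by (auto simp: directed_def)

lemma directed_conj: "directed d f \<Longrightarrow> directed d g \<Longrightarrow> directed d (\<lambda>k. f k \<and> g k)"
  by (cases d) (auto simp: directed_def)

lemma directed_disj: "directed d f \<Longrightarrow> directed d g \<Longrightarrow> directed d (\<lambda>k. f k \<or> g k)"
  by (cases d) (auto simp: directed_def)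

lemma directed_quantify:
  "(\<And>l. directed d (\<lambda>k. f k l)) \<Longrightarrow> directed d (\<lambda>k. quantify q (f k))"
  unfolding directed_def by (cases d; cases q) (simp_all, blast+)

lemma directed_both: "directed True f \<Longrightarrow> directed False f \<Longrightarrow> f k = f l"
  by (metis directed_def linear)

text \<open>With an arbitrary objective \<open>W\<close>, so that numbers of agents and objective
  can be varied separately.\<close>

definition strat :: "'s hdmas \<Rightarrow> 's \<Rightarrow> nat \<Rightarrow> nat \<Rightarrow> ((nat \<Rightarrow> 's) \<Rightarrow> bool) \<Rightarrow> bool" where
  "strat M s C N W \<longleftrightarrow> (\<exists>\<sigma>. joint_strategy M C \<sigma> \<and> (\<forall>\<pi>. play M \<sigma> N s \<pi> \<longrightarrow> W \<pi>))"

lemma sat_Strat: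
  "sat M s \<theta> (Strat t1 t2 \<chi>) \<longleftrightarrow> strat M s (\<theta> t1) (\<theta> t2) (\<lambda>\<pi>. psat M \<pi> \<theta> \<chi>)"
  by (simp add: strat_def)

lemma play_states: "play M \<sigma> N s \<pi> \<Longrightarrow> s \<in> states M \<Longrightarrow> \<pi> i \<in> states M"
  by (cases i) (auto simp: play_def)

text \<open>Objectives matter only on paths within \<open>states M\<close>, which is where induction
  hypotheses about subformulas apply.\<close>

lemma strat_mono_path:
  assumes "strat M s C N W" "s \<in> states M"
    and "\<And>\<pi>. (\<And>i. \<pi> i \<in> states M) \<Longrightarrow> W \<pi> \<Longrightarrow> W' \<pi>"
  shows "strat M s C N W'"
  using assms play_states unfolding strat_def by metis

lemma strat_cong:
  assumes "s \<in> states M" and "\<And>\<pi>. (\<And>i. \<pi> i \<in> states M) \<Longrightarrow> W \<pi> = W' \<pi>"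
  shows "strat M s C N W = strat M s C N W'"
  using assms strat_mono_path[of M s C N] by blast

lemma distribution_add_idle:
  assumes "is_hdmas M" "s \<in> states M" "distribution M s C c"
  shows "distribution M s (C + n) (c(Idle := c Idle + n))"
proof -
  have fin: "finite (avail M s)" and idle: "Idle \<in> avail M s"
    using assms(1,2) by (auto simp: is_hdmas_def actions_def intro: finite_subset)
  have "(\<Sum>a\<in>avail M s - {Idle}. (c(Idle := c Idle + n)) a) = (\<Sum>a\<in>avail M s - {Idle}. c a)"
    by (rule sum.cong) auto
  then show ?thesis
    using assms(3) fin idle
    by (auto simp: distribution_def over_avail_def sum.remove[of "avail M s" Idle])
qed

text \<open>Guards do not read the counter of \<open>Idle\<close>: if the additional members idle,
  the plays stay the same.\<close>

lemma strat_mono_coalition: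
  assumes "is_hdmas M" "s \<in> states M" "strat M s C N W" "C \<le> C'"
  shows "strat M s C' N W"
proof -
  obtain \<sigma> where \<sigma>: "joint_strategy M C \<sigma>" "\<And>\<pi>. play M \<sigma> N s \<pi> \<Longrightarrow> W \<pi>"
    using assms(3) unfolding strat_def by blast
  define \<tau> where "\<tau> s = (\<sigma> s)(Idle := \<sigma> s Idle + (C' - C))" for s
  have "joint_strategy M C' \<tau>"
    using \<sigma>(1) distribution_add_idle[OF assms(1), of _ C _ "C' - C"] assms(4)
    by (auto simp: joint_strategy_def \<tau>_def)
  moreover have "play M \<tau> N s \<pi> = play M \<sigma> N s \<pi>" for \<pi>
    by (simp add: play_def enabled_def \<tau>_def)
  ultimately show ?thesis
    using \<sigma>(2) unfolding strat_def by auto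
qed

text \<open>Additional opponents may idle, so a play against fewer opponents is also one against
  more, and the same strategy wins.\<close>

lemma strat_mono_opponents:
  assumes "is_hdmas M" "s \<in> states M" "strat M s C N W" "N' \<le> N"
  shows "strat M s C N' W"
proof -
  have "play M \<sigma> N s \<pi>" if p: "play M \<sigma> N' s \<pi>" for \<sigma> \<pi>
    unfolding play_def
  proof (intro conjI allI)
    show "\<pi> 0 = s" using p by (simp add: play_def)
    fix i
    show "\<pi> (Suc i) \<in> states M" using p by (simp add: play_def)
    obtain c where c: "distribution M (\<pi> i) N' c"
        "enabled M (\<pi> i) (\<lambda>a. \<sigma> (\<pi> i) a + c a) (\<pi> (Suc i))"
      using p by (auto simp: play_def)
    have "distribution M (\<pi> i) N (c(Idle := c Idle + (N - N')))"
      using distribution_add_idle[OF assms(1) play_states[OF p assms(2)] c(1), of "N - N'"] assms(4)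
      by simp
    moreover have "enabled M (\<pi> i) (\<lambda>a. \<sigma> (\<pi> i) a + (c(Idle := c Idle + (N - N'))) a) (\<pi> (Suc i))"
      using c(2) by (simp add: enabled_def)
    ultimately show "\<exists>c. distribution M (\<pi> i) N c \<and>
        enabled M (\<pi> i) (\<lambda>a. \<sigma> (\<pi> i) a + c a) (\<pi> (Suc i))"
      by blast
  qed
  then show ?thesis
    using assms(3) unfolding strat_def by blast
qed

section \<open>Path formulas and quantifier prefixes as operators on truth values\<close>

text \<open>The truth of the operands is abstracted to \<open>X\<close>, so it can be replaced by
  quantified truth under the same temporal operator.\<close>

primrec pholds :: "pfm \<Rightarrow> (sfm \<Rightarrow> 's \<Rightarrow> bool) \<Rightarrow> (nat \<Rightarrow> 's) \<Rightarrow> bool" where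
  "pholds (Next \<phi>) X \<pi> \<longleftrightarrow> X \<phi> (\<pi> 1)"
| "pholds (Always \<phi>) X \<pi> \<longleftrightarrow> (\<forall>i. X \<phi> (\<pi> i))"
| "pholds (Until \<psi> \<phi>) X \<pi> \<longleftrightarrow> (\<exists>i. X \<phi> (\<pi> i) \<and> (\<forall>j<i. X \<psi> (\<pi> j)))"

lemma psat_pholds: "psat M \<pi> \<theta> \<chi> \<longleftrightarrow> pholds \<chi> (\<lambda>\<phi> s. sat M s \<theta> \<phi>) \<pi>"
  by (cases \<chi>) auto

lemma psat_pnp: "psat M \<pi> \<theta> (pnp Q \<chi>) \<longleftrightarrow> pholds \<chi> (\<lambda>\<phi> s. sat M s \<theta> (np Q \<phi>)) \<pi>"
  by (cases \<chi>) auto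

lemma psat_pnf: "psat M \<pi> \<theta> (pnf \<chi>) \<longleftrightarrow> pholds \<chi> (\<lambda>\<phi> s. sat M s \<theta> (nf \<phi>)) \<pi>"
  by (cases \<chi>) auto

lemma pholds_mono:
  assumes "\<And>\<phi> i. \<phi> \<in> psubs \<chi> \<Longrightarrow> X \<phi> (\<pi> i) \<Longrightarrow> X' \<phi> (\<pi> i)" and "pholds \<chi> X \<pi>"
  shows "pholds \<chi> X' \<pi>"
  using assms by (cases \<chi>) (simp_all, blast)

lemma pholds_cong:
  assumes "\<And>\<phi> i. \<phi> \<in> psubs \<chi> \<Longrightarrow> X \<phi> (\<pi> i) = X' \<phi> (\<pi> i)"
  shows "pholds \<chi> X \<pi> = pholds \<chi> X' \<pi>"
  using assms by (cases \<chi>) auto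

primrec qsem ::
    "(quant \<times> yvar) list \<Rightarrow> ((tm \<Rightarrow> nat) \<Rightarrow> bool) \<Rightarrow> (tm \<Rightarrow> nat) \<Rightarrow> bool" where
  "qsem [] F \<theta> = F \<theta>"
| "qsem (qv # qs) F \<theta> = quantify (fst qv) (\<lambda>k. qsem qs F (\<theta>(Y (snd qv) := k)))"

lemma sat_Pre: "sat M s \<theta> (Pre P \<phi>) \<longleftrightarrow> qsem (quants P) (\<lambda>\<theta>. sat M s \<theta> \<phi>) \<theta>"
  by (cases P) auto

lemma qsem_Nil: "qsem [] F = F"
  by (simp add: fun_eq_iff)

lemma quantify_const [simp]: "quantify q (\<lambda>k. c) = c"
  by (cases q) auto

lemma qsem_const [simp]: "qsem qs (\<lambda>\<theta>. c) \<theta> = c"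
  by (induction qs arbitrary: \<theta>) auto

lemma qsem_upd:
  "v \<in> snd ` set qs \<Longrightarrow> qsem qs F (\<theta>(Y v := k)) = qsem qs F \<theta>"
proof (induction qs arbitrary: \<theta>)
  case (Cons qv qs)
  show ?case
  proof (cases "v = snd qv")
    case False
    then have "v \<in> snd ` set qs" and
      "\<theta>(Y v := k, Y (snd qv) := l) = \<theta>(Y (snd qv) := l, Y v := k)" for l
      using Cons.prems by (auto simp: fun_eq_iff)
    then show ?thesis by (simp only: qsem.simps Cons.IH)
  next
    case True
    then show ?thesis by (simp only: qsem.simps fun_upd_upd)
  qed
qed simp

lemma directed_in_qsem: "directed_in v d F \<Longrightarrow> directed_in v d (qsem qs F)"
proof (induction qs)
  case (Cons qv qs)
  then have IH: "directed d (\<lambda>k. qsem qs F (\<theta>(Y v := k)))" for \<theta>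
    by (simp add: directed_in_def)
  show ?case
  proof (cases "v = snd qv")
    case False
    then show ?thesis
      unfolding directed_in_def
      by (auto simp: fun_upd_twist[of "Y v"] intro!: directed_quantify IH)
  qed (simp add: directed_in_def)
qed (simp add: directed_in_def)

text \<open>With the objective fixed, truth is upward in the coalition, downward in the opponents,
  and constant if \<open>v\<close> is neither number.\<close>

lemma directed_in_strat:
  assumes M: "is_hdmas M" "s \<in> states M" and t: "t1 \<noteq> Y Y2" "t2 \<noteq> Y Y1"
    and d: "has_yvar v t1 t2 \<Longrightarrow> d = (v = Y1)"
  shows "directed_in v d (\<lambda>\<theta>. strat M s (\<theta> t1) (\<theta> t2) W)"
proof (cases v)
  case Y1
  then show ?thesis
    using t d strat_mono_coalition[OF M] by (auto simp: directed_in_def directed_def)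
next
  case Y2
  then show ?thesis
    using t d strat_mono_opponents[OF M] by (auto simp: directed_in_def directed_def)
qed

text \<open>\<open>e\<close> is the common parity of the free occurrences, \<open>True\<close> for
  even. At even occurrences truth is upward in \<open>y1\<close> and downward in \<open>y2\<close>,
  at odd ones conversely.\<close>

lemma directed_in_sat:
  assumes "is_hdmas M" "wf_sfm \<phi>" "\<forall>n\<in>negs v \<phi>. even n = e" "s \<in> states M"
  shows "directed_in v (e = (v = Y1)) (\<lambda>\<theta>. sat M s \<theta> \<phi>)"
  using assms(2-)
proof (induction \<phi> arbitrary: s e rule: sfm_induct)
  case (Neg \<phi>)
  have "\<forall>n\<in>negs v \<phi>. even n = (\<not> e)"
    using Neg.prems by auto
  then have "directed_in v ((\<not> e) = (v = Y1)) (\<lambda>\<theta>. sat M s \<theta> \<phi>)"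
    using Neg.prems by (intro Neg.IH) simp_all
  then show ?case
    by (cases e; cases "v = Y1") (simp_all add: directed_in_def directed_not)
next
  case (And \<phi> \<psi>)
  then show ?case
    by (simp add: directed_in_def directed_conj ball_Un)
next
  case (Or \<phi> \<psi>)
  then show ?case
    by (simp add: directed_in_def directed_disj ball_Un)
next
  case (Pre P \<phi>)
  show ?case
  proof (cases "v \<in> qvars P")
    case True
    then show ?thesis
      unfolding sat_Pre directed_in_def by (simp add: qsem_upd qvars_def)
  next
    case False
    with Pre show ?thesis
      unfolding sat_Pre by (intro directed_in_qsem) simp
  qed
next
  case (Strat t1 t2 \<chi>)
  let ?d = "e = (v = Y1)"
  have t: "t1 \<noteq> Y Y2" "t2 \<noteq> Y Y1" using Strat.prems by auto
  \<comment> \<open>An occurrence in this very operator lies under no negation, so \<open>e\<close>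
    is \<open>True\<close>.\<close>
  have d: "?d = (v = Y1)" if "has_yvar v t1 t2"
    using Strat.prems(2) that has_yvar_negs[of v t1 t2 \<chi>] by fastforce
  have sub: "directed_in v ?d (\<lambda>\<theta>. sat M s' \<theta> \<phi>)" if "\<phi> \<in> psubs \<chi>" "s' \<in> states M" for \<phi> s'
    using Strat.IH[OF that(1)] Strat.prems that by (auto simp: wf_pfm_psubs pnegs_psubs)
  have G: "directed_in v ?d (\<lambda>\<theta>. strat M s (\<theta> t1) (\<theta> t2) W)" for W
    using directed_in_strat[OF assms(1) Strat.prems(3) t d] .
  \<comment> \<open>An update of \<open>v\<close> is made in two stages: \<open>G\<close> changes
    the numbers of agents under a fixed objective, then \<open>step\<close> exchanges the objective
    under fixed numbers.\<close>
  have step: "strat M s C N (\<lambda>\<pi>. psat M \<pi> \<theta>' \<chi>)"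
    if "strat M s C N (\<lambda>\<pi>. psat M \<pi> \<theta> \<chi>)"
      and imp: "\<And>\<phi> s. \<phi> \<in> psubs \<chi> \<Longrightarrow> s \<in> states M \<Longrightarrow> sat M s \<theta> \<phi> \<Longrightarrow> sat M s \<theta>' \<phi>" for C N \<theta> \<theta>'
    using that(1) Strat.prems(3)
  proof (rule strat_mono_path)
    fix \<pi> :: "nat \<Rightarrow> 'a"
    assume \<pi>: "\<And>i. \<pi> i \<in> states M" and "psat M \<pi> \<theta> \<chi>"
    from this(2) show "psat M \<pi> \<theta>' \<chi>"
      unfolding psat_pholds
    proof (rule pholds_mono[rotated])
      show "sat M (\<pi> i) \<theta>' \<phi>" if "\<phi> \<in> psubs \<chi>" "sat M (\<pi> i) \<theta> \<phi>" for \<phi> i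
        by (rule imp[OF that(1) \<pi> that(2)])
    qed
  qed
  show ?case
    unfolding sat_Strat directed_in_def directed_def
  proof (intro allI impI)
    fix \<theta> :: "tm \<Rightarrow> nat" and k l :: nat
    assume kl: "k \<le> l"
    let ?k = "\<theta>(Y v := k)" and ?l = "\<theta>(Y v := l)"
    show "if ?d
      then strat M s (?k t1) (?k t2) (\<lambda>\<pi>. psat M \<pi> ?k \<chi>) \<longrightarrow> strat M s (?l t1) (?l t2) (\<lambda>\<pi>. psat M \<pi> ?l \<chi>)
      else strat M s (?l t1) (?l t2) (\<lambda>\<pi>. psat M \<pi> ?l \<chi>) \<longrightarrow> strat M s (?k t1) (?k t2) (\<lambda>\<pi>. psat M \<pi> ?k \<chi>)"
    proof (cases ?d)
      case True
      have "strat M s (?l t1) (?l t2) (\<lambda>\<pi>. psat M \<pi> ?l \<chi>)"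
        if "strat M s (?k t1) (?k t2) (\<lambda>\<pi>. psat M \<pi> ?k \<chi>)"
      proof (rule step)
        show "strat M s (?l t1) (?l t2) (\<lambda>\<pi>. psat M \<pi> ?k \<chi>)"
          using that G True kl unfolding directed_in_def directed_def by (simp only: if_True)
        show "sat M s' ?l \<phi>" if "\<phi> \<in> psubs \<chi>" "s' \<in> states M" "sat M s' ?k \<phi>" for \<phi> s'
          using sub[OF that(1,2)] that(3) True kl unfolding directed_in_def directed_def
          by (simp only: if_True)
      qed
      then show ?thesis unfolding if_P[OF True] by blast
    next
      case False
      have "strat M s (?k t1) (?k t2) (\<lambda>\<pi>. psat M \<pi> ?k \<chi>)"
        if "strat M s (?l t1) (?l t2) (\<lambda>\<pi>. psat M \<pi> ?l \<chi>)"
      proof (rule step)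
        show "strat M s (?k t1) (?k t2) (\<lambda>\<pi>. psat M \<pi> ?l \<chi>)"
          using that G False kl unfolding directed_in_def directed_def by (simp only: if_False)
        show "sat M s' ?k \<phi>" if "\<phi> \<in> psubs \<chi>" "s' \<in> states M" "sat M s' ?l \<phi>" for \<phi> s'
          using sub[OF that(1,2)] that(3) False kl unfolding directed_in_def directed_def
          by (simp only: if_False)
      qed
      then show ?thesis unfolding if_not_P[OF False] by blast
    qed
  qed
qed (simp_all add: directed_in_def)

text \<open>Without free occurrences the parity condition holds for both parities, so truth is
  monotone in both directions and hence constant.\<close>

lemma sat_closed:
  assumes "is_hdmas M" "wf_sfm \<phi>" "negs v \<phi> = {}" "s \<in> states M"
  shows "sat M s (\<theta>(Y v := k)) \<phi> = sat M s \<theta> \<phi>"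
proof -
  have "directed_in v d (\<lambda>\<theta>. sat M s \<theta> \<phi>)" for d
  proof -
    have "((d = (v = Y1)) = (v = Y1)) = d" by blast
    then show ?thesis
      using directed_in_sat[OF assms(1,2) _ assms(4), of v "d = (v = Y1)"] assms(3) by simp
  qed
  then have "sat M s (\<theta>(Y v := k)) \<phi> = sat M s (\<theta>(Y v := \<theta> (Y v))) \<phi>"
    unfolding directed_in_def using directed_both by blast
  then show ?thesis by simp
qed

section \<open>Pushing quantifiers inwards\<close>

text \<open>A quantifier over a directed family takes either the value at \<open>0\<close> or the eventual value,
  depending only on the quantifier and the direction; for finitely many families, the eventual
  values are reached simultaneously.\<close>

lemma quantify_freeze:
  assumes I: "finite I" and f: "\<And>i. i \<in> I \<Longrightarrow> directed d (f i)"
    and G: "\<And>X. directed d (\<lambda>k. G k X)" and Gf: "directed d (\<lambda>k. G k (\<lambda>i. f i k))"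
    and cong: "\<And>k X X'. (\<And>i. i \<in> I \<Longrightarrow> X i = X' i) \<Longrightarrow> G k X = G k X'"
  shows "quantify q (\<lambda>k. G k (\<lambda>i. f i k)) = quantify q (\<lambda>k. G k (\<lambda>i. quantify q (f i)))"
proof (cases "(q = Forall) = d")
  case True
  \<comment> \<open>Universal over an upward family or existential over a downward one: the argument
    \<open>0\<close> decides.\<close>
  have at_0: "quantify q g = g 0" if "directed d g" for g
    using that True by (cases q) (auto simp: directed_def)
  show ?thesis
    by (subst at_0[OF Gf], subst at_0[OF G], rule cong) (simp add: at_0 f)
next
  case False
  \<comment> \<open>In the remaining case any tail decides, so the first \<open>m\<close> arguments
    can be skipped.\<close>
  have shift: "quantify q g = quantify q (\<lambda>k. g (k + m))" if "directed d g" for g m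
  proof (cases q)
    case Forall
    with that False show ?thesis unfolding directed_def by simp (metis le_add1)
  next
    case Exists
    with that False show ?thesis unfolding directed_def by simp (metis le_add1)
  qed
  have "\<forall>\<^sub>F k in sequentially. f i k = quantify q (f i)" if i: "i \<in> I" for i
  proof -
    have "\<exists>m. \<forall>k\<ge>m. f i k = quantify q (f i)"
    proof (cases q)
      case Forall
      with False f[OF i] show ?thesis unfolding directed_def by simp blast
    next
      case Exists
      with False f[OF i] show ?thesis unfolding directed_def by simp blast
    qed
    then show ?thesis by (simp add: eventually_sequentially)
  qed
  \<comment> \<open>Each family is eventually constant; finiteness of \<open>I\<close> gives a
    common threshold.\<close>
  then have "\<forall>\<^sub>F k in sequentially. \<forall>i\<in>I. f i k = quantify q (f i)"
    using I by (simp add: eventually_ball_finite)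
  then obtain m where m: "\<And>k i. i \<in> I \<Longrightarrow> f i (k + m) = quantify q (f i)"
    unfolding eventually_sequentially by (meson le_add2)
  have "G (k + m) (\<lambda>i. f i (k + m)) = G (k + m) (\<lambda>i. quantify q (f i))" for k
    by (rule cong) (rule m)
  then show ?thesis
    using shift[OF Gf, where m = m] shift[OF G, where m = m] by simp
qed

text \<open>Only the values passed as \<open>X\<close> are frozen; the direct dependence of
  \<open>G\<close> on the assignment stays under the quantifiers. \<open>quantify_freeze\<close> is
  applied once per quantifier.\<close>

lemma qsem_freeze:
  assumes I: "finite I"
    and f: "\<And>i v. i \<in> I \<Longrightarrow> v \<in> snd ` set qs \<Longrightarrow> directed_in v (d v) (f i)"
    and G: "\<And>X v. v \<in> snd ` set qs \<Longrightarrow> directed_in v (d v) (\<lambda>\<theta>. G \<theta> X)"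
    and Gf: "\<And>v. v \<in> snd ` set qs \<Longrightarrow> directed_in v (d v) (\<lambda>\<theta>. G \<theta> (\<lambda>i. f i \<theta>))"
    and cong: "\<And>\<theta> X X'. (\<And>i. i \<in> I \<Longrightarrow> X i = X' i) \<Longrightarrow> G \<theta> X = G \<theta> X'"
  shows "qsem qs (\<lambda>\<theta>'. G \<theta>' (\<lambda>i. f i \<theta>')) \<theta> = qsem qs (\<lambda>\<theta>'. G \<theta>' (\<lambda>i. qsem qs (f i) \<theta>)) \<theta>"
  using f G Gf
proof (induction qs arbitrary: \<theta>)
  case (Cons qv qs)
  obtain q v where qv: "qv = (q, v)" by fastforce
  let ?u = "\<lambda>k. \<theta>(Y v := k)"
  have IH: "qsem qs (\<lambda>\<theta>'. G \<theta>' (\<lambda>i. f i \<theta>')) \<theta> =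
      qsem qs (\<lambda>\<theta>'. G \<theta>' (\<lambda>i. qsem qs (f i) \<theta>)) \<theta>" for \<theta>
    using Cons by simp
  have dir: "directed (d v) (\<lambda>k. qsem qs F (?u k))" if "directed_in v (d v) F" for F
    using directed_in_qsem[OF that, of qs] by (simp add: directed_in_def)
  have "quantify q (\<lambda>k. qsem qs (\<lambda>\<theta>'. G \<theta>' (\<lambda>i. qsem qs (f i) (?u k))) (?u k)) =
      quantify q (\<lambda>k. qsem qs (\<lambda>\<theta>'. G \<theta>' (\<lambda>i. quantify q (\<lambda>k. qsem qs (f i) (?u k)))) (?u k))"
  proof (rule quantify_freeze[OF I, where d = "d v" and f = "\<lambda>i k. qsem qs (f i) (?u k)"
        and G = "\<lambda>k X. qsem qs (\<lambda>\<theta>'. G \<theta>' X) (?u k)"])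
    show "directed (d v) (\<lambda>k. qsem qs (f i) (?u k))" if "i \<in> I" for i
      using Cons.prems(1)[OF that, of v] by (intro dir) (simp add: qv)
    show "directed (d v) (\<lambda>k. qsem qs (\<lambda>\<theta>'. G \<theta>' X) (?u k))" for X
      using Cons.prems(2)[of v X] by (intro dir) (simp add: qv)
    \<comment> \<open>Freezing the inner values does not change the family, by \<open>IH\<close>, so
      directedness can be shown for the unfrozen one.\<close>
    show "directed (d v) (\<lambda>k. qsem qs (\<lambda>\<theta>'. G \<theta>' (\<lambda>i. qsem qs (f i) (?u k))) (?u k))"
      unfolding IH[symmetric] using Cons.prems(3)[of v] by (intro dir) (simp add: qv)
    show "qsem qs (\<lambda>\<theta>'. G \<theta>' X) (?u k) = qsem qs (\<lambda>\<theta>'. G \<theta>' X') (?u k)"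
      if "\<And>i. i \<in> I \<Longrightarrow> X i = X' i" for k X X'
      using cong[OF that] by simp
  qed
  then show ?case
    by (simp add: qv IH)
qed simp

lemma qsem_dual: "qsem (quants (dual_prefix Q)) F \<theta> \<longleftrightarrow> \<not> qsem (quants Q) (\<lambda>\<theta>. \<not> F \<theta>) \<theta>"
proof -
  have *: "quantify (dual q) g \<longleftrightarrow> \<not> quantify q (\<lambda>k. \<not> g k)" for q g
    by (cases q) auto
  show ?thesis by (cases Q) (simp_all add: *)
qed

lemma qsem_absorb: "qsem (quants (absorb Q (q, k))) F = qsem (quants Q) (qsem [(q, k)] F)"
proof (cases Q)
  case (One q' i)
  show ?thesis
  proof (cases "i = k")
    case False
    then have "other i = k" using UNIV_yvar[of i] by auto
    with False show ?thesis by (simp add: One fun_eq_iff)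
  qed (simp add: One fun_eq_iff)
next
  case (Two q' i q'')
  show ?thesis
  proof (cases "i = k")
    case True
    then show ?thesis by (simp add: Two fun_eq_iff fun_upd_twist[of "Y k"])
  next
    case False
    then have "other i = k" using UNIV_yvar[of i] by auto
    with False show ?thesis by (simp add: Two fun_eq_iff)
  qed
qed

lemma qsem_foldl_absorb:
  "qsem (quants (foldl absorb Q qs)) F = qsem (quants Q) (qsem qs F)"
proof (induction qs arbitrary: Q)
  case (Cons qv qs)
  have "qsem [qv] (qsem qs F) = qsem (qv # qs) F"
    by (simp add: fun_eq_iff)
  then show ?case
    by (cases qv) (simp only: foldl.simps Cons.IH qsem_absorb)
qed (simp add: qsem_Nil)

text \<open>The variables of \<open>Q\<close> are not free in \<open>\<chi>\<close>, so the
  objective stays at \<open>\<theta>\<close> while only the numbers of agents vary; monotonicity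
  decides vacuous quantifiers at \<open>0\<close>.\<close>

lemma sat_place_elim:
  assumes M: "is_hdmas M" "s \<in> states M" and t: "t1 \<noteq> Y Y2" "t2 \<noteq> Y Y1"
    and wf: "wf_pfm \<chi>" and cl: "\<And>v. v \<in> qvars Q \<Longrightarrow> pnegs v \<chi> = {}" and \<theta>: "assignment \<theta>"
  shows "sat M s \<theta> (place_elim Q t1 t2 \<chi>) \<longleftrightarrow>
    qsem (quants Q) (\<lambda>\<theta>'. strat M s (\<theta>' t1) (\<theta>' t2) (\<lambda>\<pi>. psat M \<pi> \<theta> \<chi>)) \<theta>"
proof -
  have upd: "strat M s C N (\<lambda>\<pi>. psat M \<pi> (\<theta>(Y v := k)) \<chi>) = strat M s C N (\<lambda>\<pi>. psat M \<pi> \<theta> \<chi>)"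
    if "v \<in> qvars Q" for v k C N \<theta>
    using M(2)
  proof (rule strat_cong)
    fix \<pi> :: "nat \<Rightarrow> 'a" assume "\<And>i. \<pi> i \<in> states M"
    then show "psat M \<pi> (\<theta>(Y v := k)) \<chi> = psat M \<pi> \<theta> \<chi>"
      unfolding psat_pholds using sat_closed[OF M(1)] wf cl[OF that]
      by (intro pholds_cong) (simp add: wf_pfm_psubs pnegs_psubs)
  qed
  let ?W = "\<lambda>\<pi>. psat M \<pi> \<theta> \<chi>"
  have z: "\<theta> (Num 0) = 0" using \<theta> by (simp add: assignment_def)
  have up: "strat M s 0 N ?W \<Longrightarrow> strat M s C N ?W" for C N
    using strat_mono_coalition[OF M, of 0 N ?W C] by simp
  have down: "strat M s C N ?W \<Longrightarrow> strat M s C 0 ?W" for C N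
    using strat_mono_opponents[OF M, of C N ?W 0] by simp
  have 1: "(\<forall>k. strat M s k N ?W) = strat M s 0 N ?W" for N using up by blast
  have 2: "(\<exists>k. strat M s C k ?W) = strat M s C 0 ?W" for C using down by blast
  have 3: "(\<forall>k l. strat M s k l ?W) = (\<forall>l. strat M s 0 l ?W)"
    "(\<exists>k l. strat M s k l ?W) = (\<exists>k. strat M s k 0 ?W)" 
    "(\<exists>l k. strat M s k l ?W) = (\<exists>k. strat M s k 0 ?W)" using up down by blast+
  show ?thesis
  proof (cases Q)
    case (One q v)
    then show ?thesis using t z
      by (cases q; cases v; cases "t1 = Y Y1"; cases "t2 = Y Y2")
        (simp_all add: place_elim_def zero_if_def tm_zero_def vacuous_def sat_Strat 1 2 upd del: sat.simps(6))
  next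
    case (Two q v q')
    then show ?thesis using t z
      by (cases q; cases v; cases q'; cases "t1 = Y Y1"; cases "t2 = Y Y2")
        (simp_all add: place_elim_def zero_if_def tm_zero_def vacuous_def sat_Strat 1 2 3 upd Let_def
          del: sat.simps(6))
  qed
qed

text \<open>A common direction lets every quantifier distribute over both connectives. This is
  \<open>qsem_freeze\<close> for two families indexed by the Booleans.\<close>

lemma qsem_junction:
  fixes A B :: "(tm \<Rightarrow> nat) \<Rightarrow> bool"
  assumes A: "\<And>v. v \<in> snd ` set qs \<Longrightarrow> directed_in v (d v) A"
    and B: "\<And>v. v \<in> snd ` set qs \<Longrightarrow> directed_in v (d v) B"
  shows "qsem qs (\<lambda>\<theta>. A \<theta> \<and> B \<theta>) \<theta> \<longleftrightarrow> qsem qs A \<theta> \<and> qsem qs B \<theta>"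
    and "qsem qs (\<lambda>\<theta>. A \<theta> \<or> B \<theta>) \<theta> \<longleftrightarrow> qsem qs A \<theta> \<or> qsem qs B \<theta>"
proof -
  let ?f = "\<lambda>b. if b then A else B"
  have f: "directed_in v (d v) (?f b)" if "v \<in> snd ` set qs" for b v
    using A[OF that] B[OF that] by simp
  have "qsem qs (\<lambda>\<theta>. ?f True \<theta> \<and> ?f False \<theta>) \<theta> =
      qsem qs (\<lambda>\<theta>'. qsem qs (?f True) \<theta> \<and> qsem qs (?f False) \<theta>) \<theta>"
  proof (rule qsem_freeze[where I = UNIV and f = ?f and d = d and G = "\<lambda>\<theta> X. X True \<and> X False"])
    fix v assume v: "v \<in> snd ` set qs"
    show "directed_in v (d v) (?f b)" for b by (rule f[OF v])
    show "directed_in v (d v) (\<lambda>\<theta>. ?f True \<theta> \<and> ?f False \<theta>)"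
      using A[OF v] B[OF v] by (simp add: directed_in_def directed_conj)
  qed (simp_all add: directed_in_def)
  then show "qsem qs (\<lambda>\<theta>. A \<theta> \<and> B \<theta>) \<theta> \<longleftrightarrow> qsem qs A \<theta> \<and> qsem qs B \<theta>"
    by simp
  have "qsem qs (\<lambda>\<theta>. ?f True \<theta> \<or> ?f False \<theta>) \<theta> =
      qsem qs (\<lambda>\<theta>'. qsem qs (?f True) \<theta> \<or> qsem qs (?f False) \<theta>) \<theta>"
  proof (rule qsem_freeze[where I = UNIV and f = ?f and d = d and G = "\<lambda>\<theta> X. X True \<or> X False"])
    fix v assume v: "v \<in> snd ` set qs"
    show "directed_in v (d v) (?f b)" for b by (rule f[OF v])
    show "directed_in v (d v) (\<lambda>\<theta>. ?f True \<theta> \<or> ?f False \<theta>)"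
      using A[OF v] B[OF v] by (simp add: directed_in_def directed_disj)
  qed (simp_all add: directed_in_def)
  then show "qsem qs (\<lambda>\<theta>. A \<theta> \<or> B \<theta>) \<theta> \<longleftrightarrow> qsem qs A \<theta> \<or> qsem qs B \<theta>"
    by simp
qed

text \<open>The parity \<open>e v\<close> is arbitrary because negation flips it while dualising the
  prefix. Finiteness of the state space is used in the strategic case.\<close>

lemma sat_np:
  fixes M :: "'s hdmas"
  assumes M: "is_hdmas M" "finite (states M)" and "wf_sfm \<phi>" "s \<in> states M" "assignment \<theta>"
    and "\<And>v. v \<in> qvars Q \<Longrightarrow> \<forall>n\<in>negs v \<phi>. even n = e v"
  shows "sat M s \<theta> (np Q \<phi>) \<longleftrightarrow> qsem (quants Q) (\<lambda>\<theta>. sat M s \<theta> \<phi>) \<theta>"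
  using assms(3-)
proof (induction \<phi> arbitrary: s Q e rule: sfm_induct)
  case (Neg \<phi>)
  have "\<forall>n\<in>negs v \<phi>. even n = (\<not> e v)" if "v \<in> qvars Q" for v
    using Neg.prems(4)[OF that] by auto
  then show ?case
    using Neg.IH[where s = s and Q = "dual_prefix Q" and e = "\<lambda>v. \<not> e v"] Neg.prems by (simp add: qsem_dual)
next
  case (And \<phi> \<psi>)
  then show ?case
    using And.IH(1)[where s = s and Q = Q and e = e] And.IH(2)[where s = s and Q = Q and e = e]
      qsem_junction(1)[of "quants Q" "\<lambda>v. e v = (v = Y1)" "\<lambda>\<theta>. sat M s \<theta> \<phi>" "\<lambda>\<theta>. sat M s \<theta> \<psi>" \<theta>]
    by (simp add: directed_in_sat[OF M(1)] qvars_def[symmetric] ball_Un)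
next
  case (Or \<phi> \<psi>)
  then show ?case
    using Or.IH(1)[where s = s and Q = Q and e = e] Or.IH(2)[where s = s and Q = Q and e = e]
      qsem_junction(2)[of "quants Q" "\<lambda>v. e v = (v = Y1)" "\<lambda>\<theta>. sat M s \<theta> \<phi>" "\<lambda>\<theta>. sat M s \<theta> \<psi>" \<theta>]
    by (simp add: directed_in_sat[OF M(1)] qvars_def[symmetric] ball_Un)
next
  case (Strat t1 t2 \<chi>)
  have t: "t1 \<noteq> Y Y2" "t2 \<noteq> Y Y1" and wf: "wf_pfm \<chi>" using Strat.prems by auto
  have sub: "\<forall>n\<in>negs v \<phi>. even n = e v" if "\<phi> \<in> psubs \<chi>" "v \<in> qvars Q" for \<phi> v
    using Strat.prems(4)[OF that(2)] that(1) by (auto simp: pnegs_psubs)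
  have wf': "wf_sfm \<phi>" if "\<phi> \<in> psubs \<chi>" for \<phi>
    using wf that by (simp add: wf_pfm_psubs)
  \<comment> \<open>The values to be frozen are indexed by pairs of an operand and a state, finitely
    many; \<open>G\<close> retains the dependence on the numbers of agents.\<close>
  define f where "f = (\<lambda>(\<phi>, s) \<theta>. sat M s \<theta> \<phi>)"
  define G where "G \<theta> X = strat M s (\<theta> t1) (\<theta> t2) (pholds \<chi> (\<lambda>\<phi> s. X (\<phi>, s)))" for \<theta> X
  have eq: "sat M s \<theta> (Strat t1 t2 \<chi>) = G \<theta> (\<lambda>i. f i \<theta>)" for \<theta>
    unfolding sat_Strat psat_pholds by (simp add: G_def f_def)
  have "sat M s \<theta> (np Q (Strat t1 t2 \<chi>)) \<longleftrightarrow>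
      qsem (quants Q) (\<lambda>\<theta>'. strat M s (\<theta>' t1) (\<theta>' t2) (\<lambda>\<pi>. psat M \<pi> \<theta> (pnp Q \<chi>))) \<theta>"
    using sat_place_elim[OF M(1) Strat.prems(2) t _ _ Strat.prems(3), where \<chi> = "pnp Q \<chi>" and Q = Q]
      normal_np[OF wf'] normal_wf pnegs_pnp[OF wf]
    by (simp add: wf_pfm_psubs)
  also have "\<dots> = qsem (quants Q) (\<lambda>\<theta>'. G \<theta>' (\<lambda>i. qsem (quants Q) (f i) \<theta>)) \<theta>"
  proof -
    have IH: "pholds \<chi> (\<lambda>\<phi> s. sat M s \<theta> (np Q \<phi>)) \<pi> = pholds \<chi> (\<lambda>\<phi> s. qsem (quants Q) (f (\<phi>, s)) \<theta>) \<pi>"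
      if "\<And>i. \<pi> i \<in> states M" for \<pi>
      using Strat.IH[OF _ wf' that Strat.prems(3) sub, where Q = Q]
      by (intro pholds_cong) (simp add: f_def)
    have "strat M s C N (\<lambda>\<pi>. psat M \<pi> \<theta> (pnp Q \<chi>)) =
        strat M s C N (pholds \<chi> (\<lambda>\<phi> s. qsem (quants Q) (f (\<phi>, s)) \<theta>))" for C N
    proof (rule strat_cong[OF Strat.prems(2)])
      fix \<pi> :: "nat \<Rightarrow> 's"
      assume "\<And>i. \<pi> i \<in> states M"
      then show "psat M \<pi> \<theta> (pnp Q \<chi>) = pholds \<chi> (\<lambda>\<phi> s. qsem (quants Q) (f (\<phi>, s)) \<theta>) \<pi>"
        unfolding psat_pnp by (rule IH)
    qed
    then show ?thesis by (simp add: G_def)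
  qed
  also have "\<dots> = qsem (quants Q) (\<lambda>\<theta>'. G \<theta>' (\<lambda>i. f i \<theta>')) \<theta>"
  proof (rule qsem_freeze[symmetric, where I = "psubs \<chi> \<times> states M" and d = "\<lambda>v. e v = (v = Y1)"])
    show "finite (psubs \<chi> \<times> states M)" using M by simp
    fix v assume "v \<in> snd ` set (quants Q)"
    then have v: "v \<in> qvars Q" by (simp add: qvars_def)
    show "directed_in v (e v = (v = Y1)) (f i)" if "i \<in> psubs \<chi> \<times> states M" for i
      using that directed_in_sat[OF M(1) wf' sub[OF _ v]] by (auto simp: f_def)
    show "directed_in v (e v = (v = Y1)) (\<lambda>\<theta>. G \<theta> X)" for X
      unfolding G_def using Strat.prems(4)[OF v] has_yvar_negs[of v t1 t2 \<chi>]
      by (intro directed_in_strat[OF M(1) Strat.prems(2) t]) fastforce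
    show "directed_in v (e v = (v = Y1)) (\<lambda>\<theta>. G \<theta> (\<lambda>i. f i \<theta>))"
      using directed_in_sat[OF M(1) Strat.prems(1) Strat.prems(4)[OF v] Strat.prems(2)]
      unfolding eq .
  next
    fix \<theta> :: "tm \<Rightarrow> nat" and X X' :: "sfm \<times> 's \<Rightarrow> bool"
    assume "\<And>i. i \<in> psubs \<chi> \<times> states M \<Longrightarrow> X i = X' i"
    then show "G \<theta> X = G \<theta> X'"
      unfolding G_def by (intro strat_cong Strat.prems(2) pholds_cong) simp
  qed
  finally show ?case unfolding eq .
next
  case (Pre P \<phi>)
  let ?Q = "foldl absorb Q (quants P)"
  \<comment> \<open>Occurrences of variables of \<open>P\<close> are even by well-formedness; other
    variables keep the parity from outside.\<close>
  let ?e = "\<lambda>v. v \<in> qvars P \<or> e v"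
  have "\<forall>n\<in>negs v \<phi>. even n = ?e v" if "v \<in> qvars ?Q" for v
    using Pre.prems(1) Pre.prems(4)[of v] that by (auto split: if_splits)
  then show ?case
    using Pre.IH[where s = s and Q = ?Q and e = ?e] Pre.prems by (simp add: qsem_foldl_absorb sat_Pre del: sat.simps(7))
qed simp_all

lemma sat_nf:
  assumes M: "is_hdmas M" "finite (states M)" and "wf_sfm \<phi>" "s \<in> states M" "assignment \<theta>"
  shows "sat M s \<theta> (nf \<phi>) \<longleftrightarrow> sat M s \<theta> \<phi>"
  using assms(3-)
proof (induction \<phi> arbitrary: s \<theta> rule: sfm_induct)
  case (Strat t1 t2 \<chi>)
  have "strat M s C N (\<lambda>\<pi>. psat M \<pi> \<theta> (pnf \<chi>)) = strat M s C N (\<lambda>\<pi>. psat M \<pi> \<theta> \<chi>)" for C N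
    unfolding psat_pholds[of _ _ _ \<chi>] psat_pnf using Strat
    by (intro strat_cong pholds_cong) (simp_all add: wf_pfm_psubs)
  then show ?case by (simp add: sat_Strat del: sat.simps(6))
next
  case (Pre P \<phi>)
  have wf: "wf_sfm \<phi>" using Pre.prems by simp
  have ev: "\<forall>n\<in>negs v (nf \<phi>). even n = True" if "v \<in> qvars P" for v
    using Pre.prems(1) nf_props[OF wf] that by auto
  have "sat M s \<theta> (nf (Pre P \<phi>)) \<longleftrightarrow> qsem (quants P) (\<lambda>\<theta>. sat M s \<theta> (nf \<phi>)) \<theta>"
    unfolding nf_Pre[OF wf]
    by (rule sat_np[OF M normal_wf Pre.prems(2,3) ev]) (use nf_props[OF wf] in auto)
  also have "\<dots> \<longleftrightarrow> sat M s \<theta> (Pre P \<phi>)"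
  proof -
    have upd: "assignment (\<theta>(Y v := k))" if "assignment \<theta>" for \<theta> v k
      using that by (simp add: assignment_def)
    have "qsem qs (\<lambda>\<theta>. sat M s \<theta> (nf \<phi>)) \<theta> = qsem qs (\<lambda>\<theta>. sat M s \<theta> \<phi>) \<theta>"
      if "assignment \<theta>" for qs \<theta>
      using that by (induction qs arbitrary: \<theta>) (simp_all add: Pre wf upd)
    then show ?thesis using Pre.prems(3) by (simp add: sat_Pre del: sat.simps(7))
  qed
  finally show ?case .
qed simp_all

section \<open>Closure properties of the recursive functions\<close>

text \<open>\<open>recursive_fn\<close> prescribes values on lists of every length; comparing at
  length \<open>k\<close> only makes rewriting possible.\<close>

definition computable :: "nat \<Rightarrow> (nat list \<Rightarrow> nat) \<Rightarrow> bool" where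
  "computable k f \<longleftrightarrow> (\<exists>g. recursive_fn k g \<and> (\<forall>xs. length xs = k \<longrightarrow> g xs = f xs))"

named_theorems computable_intros

lemma computable_recursive: "recursive_fn k f \<Longrightarrow> computable k f"
  by (auto simp: computable_def)

lemma computable_cong:
  assumes "computable k f" and "\<And>xs. length xs = k \<Longrightarrow> f xs = g xs"
  shows "computable k g"
  using assms by (auto simp: computable_def)

lemma computable_var [computable_intros]: "i < k \<Longrightarrow> computable k (\<lambda>xs. xs ! i)"
  by (intro computable_recursive recursive_fn.proj)

lemma computable_compose:
  assumes "computable (length fs) g" and "\<forall>f\<in>set fs. computable k f"
  shows "computable k (\<lambda>xs. g (map (\<lambda>f. f xs) fs))"
proof -
  obtain g' where g': "recursive_fn (length fs) g'" "\<And>ys. length ys = length fs \<Longrightarrow> g' ys = g ys"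
    using assms(1) by (auto simp: computable_def)
  obtain h where h: "\<And>f. f \<in> set fs \<Longrightarrow> recursive_fn k (h f)"
    "\<And>f xs. f \<in> set fs \<Longrightarrow> length xs = k \<Longrightarrow> h f xs = f xs"
    using bchoice[OF assms(2)[unfolded computable_def]] by blast
  have "recursive_fn k (\<lambda>xs. g' (map (\<lambda>f. f xs) (map h fs)))"
    using g'(1) h(1) by (intro recursive_fn.comp) auto
  moreover have "g' (map (\<lambda>f. f xs) (map h fs)) = g (map (\<lambda>f. f xs) fs)" if "length xs = k" for xs
  proof -
    have "map (\<lambda>f. f xs) (map h fs) = map (\<lambda>f. f xs) fs"
      using h(2)[OF _ that] by simp
    moreover have "g' (map (\<lambda>f. f xs) (map h fs)) = g (map (\<lambda>f. f xs) (map h fs))"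
      by (rule g'(2)) simp
    ultimately show ?thesis by (simp only:)
  qed
  ultimately show ?thesis
    unfolding computable_def by blast
qed

lemma computable_comp1:
  assumes "computable 1 (\<lambda>xs. F (xs ! 0))" "computable k a"
  shows "computable k (\<lambda>xs. F (a xs))"
  using computable_compose[of "[a]" "\<lambda>xs. F (xs ! 0)" k] assms by simp

lemma computable_comp2:
  assumes "computable 2 (\<lambda>xs. F (xs ! 0) (xs ! 1))" "computable k a" "computable k b"
  shows "computable k (\<lambda>xs. F (a xs) (b xs))"
  using computable_compose[of "[a, b]" "\<lambda>xs. F (xs ! 0) (xs ! 1)" k] assms
  by (simp add: numeral_2_eq_2)

lemma computable_comp3:
  assumes "computable 3 (\<lambda>xs. F (xs ! 0) (xs ! 1) (xs ! 2))"
    "computable k a" "computable k b" "computable k c"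
  shows "computable k (\<lambda>xs. F (a xs) (b xs) (c xs))"
  using computable_compose[of "[a, b, c]" "\<lambda>xs. F (xs ! 0) (xs ! 1) (xs ! 2)" k] assms
  by (simp add: numeral_3_eq_3 numeral_2_eq_2)

lemma computable_rec:
  assumes "computable k a" "computable k b" "computable (k + 2) g"
  shows "computable k (\<lambda>xs. rec_nat (a xs) (\<lambda>n r. g (n # r # xs)) (b xs))"
proof -
  let ?R = "\<lambda>a g xs. rec_nat (a (tl xs)) (\<lambda>n r. g (n # r # tl xs)) (hd xs) :: nat"
  obtain a' g' where a': "recursive_fn k a'" "\<And>xs. length xs = k \<Longrightarrow> a' xs = a xs"
    and g': "recursive_fn (k + 2) g'" "\<And>xs. length xs = k + 2 \<Longrightarrow> g' xs = g xs"
    using assms(1,3) by (auto simp: computable_def)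
  have "rec_nat (a' (tl xs)) (\<lambda>n r. g' (n # r # tl xs)) m = rec_nat (a (tl xs)) (\<lambda>n r. g (n # r # tl xs)) m"
    if "length xs = k + 1" for xs m
    using that a'(2) g'(2) by (induction m) simp_all
  then have "computable (k + 1) (?R a g)"
    using recursive_fn.prec[OF a'(1) g'(1)] unfolding computable_def by blast
  \<comment> \<open>Primitive recursion runs on the head of the list; \<open>b\<close> followed by
    all projections yields recursion up to \<open>b xs\<close> with parameters
    \<open>xs\<close>.\<close>
  then have "computable k (\<lambda>xs. ?R a g (map (\<lambda>f. f xs) (b # map (\<lambda>i xs. xs ! i) [0..<k])))"
    using assms(2) by (intro computable_compose) (auto intro: computable_var)
  moreover have "map (\<lambda>f. f xs) (map (\<lambda>i xs. xs ! i) [0..<k]) = xs" if "length xs = k" for xs :: "nat list"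
    using that by (auto simp: comp_def intro: nth_equalityI)
  ultimately show ?thesis
    by (elim computable_cong) simp
qed

lemma computable_Least:
  assumes "computable (k + 1) f" and ex: "\<And>xs. length xs = k \<Longrightarrow> \<exists>n. f (n # xs) = 0"
  shows "computable k (\<lambda>xs. LEAST n. f (n # xs) = 0)"
proof -
  obtain f' where f': "recursive_fn (k + 1) f'" "\<And>xs. length xs = k + 1 \<Longrightarrow> f' xs = f xs"
    using assms(1) by (auto simp: computable_def)
  then have "\<forall>xs. length xs = k \<longrightarrow> (\<exists>n. f' (n # xs) = 0)"
    using ex by simp
  with f' show ?thesis
    using recursive_fn.mini[OF f'(1)] by (auto simp: computable_def)
qed

section \<open>Arithmetic and case distinctions\<close>

lemma computable_Suc [computable_intros]: "computable k a \<Longrightarrow> computable k (\<lambda>xs. Suc (a xs))"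
  by (rule computable_comp1[of Suc, OF computable_recursive[OF recursive_fn.succ]])

lemma computable_const [computable_intros]: "computable k (\<lambda>xs. n)"
  by (induction n) (auto intro: computable_recursive recursive_fn.zero computable_Suc)

lemma computable_plus [computable_intros]:
  assumes "computable k a" "computable k b" shows "computable k (\<lambda>xs. a xs + b xs)"
proof -
  have rec: "rec_nat m (\<lambda>n r. Suc r) n = m + n" for m n :: nat
    by (induction n) auto
  have "computable 2 (\<lambda>xs. rec_nat (xs ! 0) (\<lambda>n r. Suc ((n # r # xs) ! 1)) (xs ! 1))"
    by (rule computable_rec[where g = "\<lambda>ys. Suc (ys ! 1)"]) (intro computable_intros; simp)+
  then show ?thesis
    using assms by - (rule computable_comp2[where F = "(+)"], simp_all add: rec)
qed

lemma computable_minus [computable_intros]: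
  assumes "computable k a" "computable k b" shows "computable k (\<lambda>xs. a xs - b xs)"
proof -
  have pred: "rec_nat 0 (\<lambda>n r. n) m = m - 1" for m :: nat
    by (cases m) auto
  have "computable 1 (\<lambda>xs. rec_nat 0 (\<lambda>n r. (n # r # xs) ! 0) (xs ! 0))"
    by (rule computable_rec[where g = "\<lambda>ys. ys ! 0"]) (intro computable_intros; simp)+
  then have p: "computable k (\<lambda>xs. a xs - 1)" if "computable k a" for k a
    using that by - (rule computable_comp1[where F = "\<lambda>m. m - 1"], simp_all add: pred)
  have rec: "rec_nat m (\<lambda>n r. r - 1) n = m - n" for m n :: nat
    by (induction n) auto
  have "computable 2 (\<lambda>xs. rec_nat (xs ! 0) (\<lambda>n r. (n # r # xs) ! 1 - 1) (xs ! 1))"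
    by (rule computable_rec[where g = "\<lambda>ys. ys ! 1 - 1"]) (intro computable_intros p; simp)+
  then show ?thesis
    using assms by - (rule computable_comp2[where F = "(-)"], simp_all add: rec[simplified])
qed

lemma computable_mult [computable_intros]:
  assumes "computable k a" "computable k b" shows "computable k (\<lambda>xs. a xs * b xs)"
proof -
  have rec: "rec_nat 0 (\<lambda>n r. r + m) n = m * n" for m n :: nat
    by (induction n) auto
  have "computable 2 (\<lambda>xs. rec_nat 0 (\<lambda>n r. (n # r # xs) ! 1 + (n # r # xs) ! 2) (xs ! 1))"
    by (rule computable_rec[where g = "\<lambda>ys. ys ! 1 + ys ! 2"]) (intro computable_intros; simp)+
  then show ?thesis
    using assms by - (rule computable_comp2[where F = "(*)"], simp_all add: rec)
qed

lemma computable_if_0: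
  assumes "computable k a" "computable k b" "computable k c"
  shows "computable k (\<lambda>xs. if a xs = 0 then b xs else c xs)"
proof -
  have rec: "rec_nat b (\<lambda>n r. c) a = (if a = 0 then b else c)" for a b c :: nat
    by (cases a) auto
  have "computable 3 (\<lambda>xs. rec_nat (xs ! 1) (\<lambda>n r. (n # r # xs) ! 4) (xs ! 0))"
    by (rule computable_rec[where g = "\<lambda>ys. ys ! 4"]) (intro computable_intros; simp)+
  then show ?thesis
    using assms by - (rule computable_comp3[where F = "\<lambda>a b c. if a = 0 then b else c"],
        simp_all add: rec del: One_nat_def)
qed

lemma computable_if_eq [computable_intros]:
  assumes "computable k a" "computable k b" "computable k c" "computable k d"
  shows "computable k (\<lambda>xs. if a xs = b xs then c xs else d xs)"
proof -
  have "computable k (\<lambda>xs. if (a xs - b xs) + (b xs - a xs) = 0 then c xs else d xs)"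
    using assms by (intro computable_if_0 computable_plus computable_minus)
  moreover have "(a xs - b xs) + (b xs - a xs) = 0 \<longleftrightarrow> a xs = b xs" for xs
    by auto
  ultimately show ?thesis by simp
qed

section \<open>Finite lookup tables\<close>

definition tabulate :: "('a \<Rightarrow> nat) \<Rightarrow> ('a \<Rightarrow> nat) \<Rightarrow> nat \<Rightarrow> nat" where
  "tabulate e f n = (if n \<in> range e then f (inv e n) else 0)"

lemma tabulate_eq: "inj e \<Longrightarrow> tabulate e f (e x) = f x"
  by (simp add: tabulate_def)

text \<open>A finite table is a finite case distinction, hence computable whatever \<open>f\<close>
  is; this covers all operations on prefixes.\<close>

lemma computable_tabulate:
  assumes "finite (UNIV :: 'a set)" "computable k a"
  shows "computable k (\<lambda>xs. tabulate (e :: 'a \<Rightarrow> nat) f (a xs))"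
proof -
  have "computable k (\<lambda>xs. if a xs \<in> A then g (a xs) else 0)" if "finite A" for A g
    using that
  proof induction
    case (insert n A)
    have "computable k (\<lambda>xs. if a xs = n then g n else if a xs \<in> A then g (a xs) else 0)"
      using assms(2) insert.IH by (intro computable_intros)
    then show ?case by (rule computable_cong) auto
  qed (simp add: computable_const)
  from this[OF finite_imageI[OF assms(1)]] show ?thesis
    unfolding tabulate_def .
qed

section \<open>Cantor pairing and division\<close>

definition pr :: "nat \<Rightarrow> nat \<Rightarrow> nat" where "pr m n = prod_encode (m, n)"
definition p1 :: "nat \<Rightarrow> nat" where "p1 n = fst (prod_decode n)"
definition p2 :: "nat \<Rightarrow> nat" where "p2 n = snd (prod_decode n)"

lemma pr_simps [simp]: "p1 (pr m n) = m" "p2 (pr m n) = n" "pr m n = pr m' n' \<longleftrightarrow> m = m' \<and> n = n'"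
  by (simp_all add: pr_def p1_def p2_def)

lemma le_pr1: "k \<le> m \<Longrightarrow> k \<le> pr m n"
  using le_prod_encode_1[of m n] by (simp add: pr_def)

lemma le_pr2: "k \<le> n \<Longrightarrow> k \<le> pr m n"
  using le_prod_encode_2[of n m] by (simp add: pr_def)

lemma le_triangle: "n \<le> triangle n"
  by (induction n) auto

text \<open>Tags of composite formulas are positive, so the codes of their components are strictly
  smaller.\<close>

lemma less_pr: "k \<le> n \<Longrightarrow> 0 < m \<Longrightarrow> k < pr m n"
  using le_triangle[of "m + n"] by (simp add: pr_def prod_encode_def)

lemma computable_triangle [computable_intros]:
  assumes "computable k a" shows "computable k (\<lambda>xs. triangle (a xs))"
proof -
  have rec: "rec_nat 0 (\<lambda>n r. r + Suc n) m = triangle m" for m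
    by (induction m) auto
  have "computable 1 (\<lambda>xs. rec_nat 0 (\<lambda>n r. (n # r # xs) ! 1 + Suc ((n # r # xs) ! 0)) (xs ! 0))"
    by (rule computable_rec[where g = "\<lambda>ys. ys ! 1 + Suc (ys ! 0)"]) (intro computable_intros; simp)+
  then show ?thesis
    using assms by - (rule computable_comp1[where F = triangle], simp_all add: rec[simplified])
qed

lemma computable_pr [computable_intros]:
  "computable k a \<Longrightarrow> computable k b \<Longrightarrow> computable k (\<lambda>xs. pr (a xs) (b xs))"
  unfolding pr_def prod_encode_def by (simp, intro computable_intros)

lemma triangle_mono: "m \<le> n \<Longrightarrow> triangle m \<le> triangle n"
  by (rule lift_Suc_mono_le) auto

lemma computable_p1_p2:
  assumes "computable k a"
  shows "computable k (\<lambda>xs. p1 (a xs))" and "computable k (\<lambda>xs. p2 (a xs))"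
proof -
  \<comment> \<open>\<open>w z\<close> is the index of the largest triangular number not above
    \<open>z\<close>, that is, the diagonal \<open>m + n\<close> on which the pair lies.\<close>
  define w where "w z = (LEAST w. Suc z - triangle (Suc w) = 0)" for z
  have w: "w (pr m n) = m + n" for m n
    unfolding w_def
  proof (rule Least_equality)
    show "Suc (pr m n) - triangle (Suc (m + n)) = 0"
      by (simp add: pr_def prod_encode_def)
    fix y assume "Suc (pr m n) - triangle (Suc y) = 0"
    then have "triangle (m + n) < triangle (Suc y)"
      by (simp add: pr_def prod_encode_def)
    then show "m + n \<le> y"
      using triangle_mono[of "Suc y" "m + n"] by (meson not_le not_less_eq_eq)
  qed
  have "computable 1 (\<lambda>xs. LEAST n. Suc ((n # xs) ! 1) - triangle (Suc ((n # xs) ! 0)) = 0)"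
  proof (rule computable_Least[where f = "\<lambda>xs. Suc (xs ! 1) - triangle (Suc (xs ! 0))"])
    show "\<exists>n. Suc ((n # xs) ! 1) - triangle (Suc ((n # xs) ! 0)) = 0" for xs
      by (rule exI[of _ "xs ! 0"]) (simp add: triangle_def)
  qed (intro computable_intros; simp)
  then have cw: "computable k (\<lambda>xs. w (a xs))"
    using assms by - (rule computable_comp1[where F = w], simp_all add: w_def)
  have p1: "p1 z = z - triangle (w z)" and p2: "p2 z = w z - p1 z" for z
  proof -
    obtain m n where "z = pr m n" by (metis pr_def prod_decode_inverse surj_pair)
    then show "p1 z = z - triangle (w z)" "p2 z = w z - p1 z"
      by (simp_all add: w) (simp add: pr_def prod_encode_def)
  qed
  show c1: "computable k (\<lambda>xs. p1 (a xs))"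
    unfolding p1 using assms cw by (intro computable_intros)
  show "computable k (\<lambda>xs. p2 (a xs))"
    unfolding p2 using c1 cw by (intro computable_intros)
qed

lemmas [computable_intros] = computable_p1_p2

text \<open>The quotient by a fixed divisor is found by minimisation, as the least \<open>n\<close>
  with \<open>m < d * Suc n\<close>.\<close>

lemma computable_div [computable_intros]:
  assumes "computable k a" "0 < d" shows "computable k (\<lambda>xs. a xs div d)"
proof -
  have least: "(LEAST n. Suc m - d * Suc n = 0) = m div d" for m
  proof (rule Least_equality)
    have "m < d * Suc (m div d)"
      using assms(2) by (metis dividend_less_times_div mult_Suc_right)
    then show "Suc m - d * Suc (m div d) = 0" by simp
    fix y assume "Suc m - d * Suc y = 0"
    then show "m div d \<le> y"
      using assms(2) by (metis Suc_le_eq diff_is_0_eq less_Suc_eq_le less_mult_imp_div_less mult.commute)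
  qed
  have "computable 1 (\<lambda>xs. LEAST n. Suc ((n # xs) ! 1) - d * Suc ((n # xs) ! 0) = 0)"
  proof (rule computable_Least[where f = "\<lambda>xs. Suc (xs ! 1) - d * Suc (xs ! 0)"])
    show "\<exists>n. Suc ((n # xs) ! 1) - d * Suc ((n # xs) ! 0) = 0" for xs
      using assms(2) by (intro exI[of _ "xs ! 0"]) (cases d; simp)
  qed (intro computable_intros; simp)
  then show ?thesis
    using assms by - (rule computable_comp1[where F = "\<lambda>m. m div d"], simp_all add: least[simplified])
qed

lemma computable_mod [computable_intros]:
  "computable k a \<Longrightarrow> 0 < d \<Longrightarrow> computable k (\<lambda>xs. a xs mod d)"
  unfolding minus_mult_div_eq_mod[symmetric] by (intro computable_intros)

section \<open>Course-of-values recursion\<close>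

text \<open>\<open>table H n\<close> is the list of the values at \<open>n - 1, \<dots>, 0\<close>, nested by \<open>pr\<close>; \<open>entry T n m\<close>
  is the value at \<open>m < n\<close> in \<open>T = table H n\<close>.\<close>

definition table :: "(nat \<Rightarrow> nat \<Rightarrow> nat) \<Rightarrow> nat \<Rightarrow> nat" where
  "table H = rec_nat 0 (\<lambda>n r. pr (H n r) r)"

definition entry :: "nat \<Rightarrow> nat \<Rightarrow> nat \<Rightarrow> nat" where
  "entry T n m = p1 ((p2 ^^ (n - Suc m)) T)"

definition cov :: "(nat \<Rightarrow> nat \<Rightarrow> nat) \<Rightarrow> nat \<Rightarrow> nat" where
  "cov H n = H n (table H n)"

text \<open>New values are paired on at the front, so the value at \<open>m\<close> lies behind
  \<open>n - Suc m\<close> later ones.\<close>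

lemma entry_table: "m < n \<Longrightarrow> entry (table H n) n m = cov H m"
proof (induction n)
  case (Suc n)
  have T: "table H (Suc n) = pr (cov H n) (table H n)"
    by (simp add: table_def cov_def)
  show ?case
  proof (cases "m = n")
    case False
    with Suc.prems have "m < n" "Suc n - Suc m = Suc (n - Suc m)" by simp_all
    with Suc.IH show ?thesis
      unfolding entry_def T by (simp only: funpow_Suc_right comp_apply pr_simps)
  qed (simp add: entry_def T)
qed simp

lemma computable_entry [computable_intros]:
  assumes "computable k a" "computable k b" "computable k c"
  shows "computable k (\<lambda>xs. entry (a xs) (b xs) (c xs))"
proof -
  have rec: "rec_nat m (\<lambda>n r. p2 r) n = (p2 ^^ n) m" for m n
    by (induction n) auto
  have "computable 2 (\<lambda>xs. rec_nat (xs ! 0) (\<lambda>n r. p2 ((n # r # xs) ! 1)) (xs ! 1))"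
    by (rule computable_rec[where g = "\<lambda>ys. p2 (ys ! 1)"]) (intro computable_intros; simp)+
  then have iter: "computable k (\<lambda>xs. (p2 ^^ (b xs)) (a xs))" if "computable k a" "computable k b" for a b
    using that by - (rule computable_comp2[where F = "\<lambda>m n. (p2 ^^ n) m"], simp_all add: rec)
  then show ?thesis
    unfolding entry_def using assms by (intro computable_intros iter)
qed

lemma computable_cov:
  assumes "computable 2 (\<lambda>xs. H (xs ! 0) (xs ! 1))" and "computable k a"
  shows "computable k (\<lambda>xs. cov H (a xs))"
proof -
  have "computable 1 (\<lambda>xs. rec_nat 0
      (\<lambda>n r. pr (H ((n # r # xs) ! 0) ((n # r # xs) ! 1)) ((n # r # xs) ! 1)) (xs ! 0))"
    by (rule computable_rec[where g = "\<lambda>ys. pr (H (ys ! 0) (ys ! 1)) (ys ! 1)"])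
      (intro computable_intros computable_comp2[OF assms(1)]; simp)+
  then have "computable 1 (\<lambda>xs. H (xs ! 0) (table H (xs ! 0)))"
    by (intro computable_comp2[OF assms(1)] computable_intros) (simp_all add: table_def)
  then show ?thesis
    using assms(2) by - (rule computable_comp1[where F = "cov H"], simp_all add: cov_def)
qed

section \<open>The normal form on Goedel numbers\<close>

text \<open>The largest code is 154, that of \<open>Two Exists Y2 Exists\<close>; 155 is the base
  that packs a formula code and a prefix code into one number.\<close>

lemma code_prefix_less: "code_prefix Q < 155"
proof (cases Q)
  case (One q v)
  then show ?thesis by (cases q; cases v) (simp_all add: prod_encode_def triangle_def)
next
  case (Two q v q')
  then show ?thesis
    by (cases q; cases v; cases q') (simp_all add: prod_encode_def triangle_def)
qed

lemma code_yvar_eq: "code_yvar v = code_yvar w \<longleftrightarrow> v = w"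
  by (cases v; cases w) auto

lemma inj_code_prefix: "inj code_prefix"
proof (rule injI)
  have q: "code_quant q = code_quant q' \<longleftrightarrow> q = q'" for q q' by (cases q; cases q') auto
  fix P Q assume "code_prefix P = code_prefix Q"
  then show "P = Q" by (cases P; cases Q) (simp_all add: q code_yvar_eq)
qed

lemma finite_qprefix: "finite (UNIV :: qprefix set)"
proof -
  have "finite (range code_prefix)"
    by (rule finite_subset[of _ "{..<155}"]) (auto intro: code_prefix_less)
  then show ?thesis
    using inj_code_prefix by (rule finite_imageD)
qed

lemma code_tm_eq_Y: "code_tm t = code_tm (Y v) \<longleftrightarrow> t = Y v"
  by (cases t) (simp_all add: code_yvar_eq)

definition dual_code :: "nat \<Rightarrow> nat" where
  "dual_code = tabulate code_prefix (\<lambda>Q. code_prefix (dual_prefix Q))"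

definition absorb_code :: "nat \<Rightarrow> nat \<Rightarrow> nat" where
  "absorb_code q p = tabulate (\<lambda>(Q, P). pr (code_prefix Q) (code_prefix P))
    (\<lambda>(Q, P). code_prefix (foldl absorb Q (quants P))) (pr q p)"

definition zeroed_code :: "yvar \<Rightarrow> nat \<Rightarrow> nat" where
  "zeroed_code v = tabulate code_prefix (\<lambda>Q. of_bool (zeroed Q v))"

text \<open>A missing prefix is coded as \<open>0\<close>, a prefix \<open>P\<close> as \<open>Suc (code_prefix P)\<close>.\<close>

definition remaining_code :: "nat \<Rightarrow> nat \<Rightarrow> nat \<Rightarrow> nat" where
  "remaining_code q a b =
    tabulate (\<lambda>(Q, a, b). pr (code_prefix Q) (pr (of_bool a) (of_bool b)))
      (\<lambda>(Q, a, b). case remaining Q (\<lambda>v. case v of Y1 \<Rightarrow> a | Y2 \<Rightarrow> b) of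
        None \<Rightarrow> 0 | Some P \<Rightarrow> Suc (code_prefix P)) (pr q (pr a b))"

definition zero_if_code :: "yvar \<Rightarrow> nat \<Rightarrow> nat \<Rightarrow> nat" where
  "zero_if_code v q t = (if zeroed_code v q = 0 then t
    else if t = code_tm (Y v) then code_tm (Num 0) else t)"

text \<open>5 and 6 are the tags of \<open>Strat\<close> and \<open>Pre\<close>;
  \<open>p - 1\<close> undoes the successor in \<open>remaining_code\<close>.\<close>

definition place_elim_code :: "nat \<Rightarrow> nat \<Rightarrow> nat \<Rightarrow> nat \<Rightarrow> nat" where
  "place_elim_code q t1 t2 c =
    (let b = pr 5 (pr (zero_if_code Y1 q t1) (pr (zero_if_code Y2 q t2) c));
         p = remaining_code q (if t1 = code_tm (Y Y1) then 1 else 0) (if t2 = code_tm (Y Y2) then 1 else 0)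
     in if p = 0 then b else pr 6 (pr (p - 1) b))"

lemma dual_code: "dual_code (code_prefix Q) = code_prefix (dual_prefix Q)"
  by (simp add: dual_code_def tabulate_eq inj_code_prefix)

lemma absorb_code:
  "absorb_code (code_prefix Q) (code_prefix P) = code_prefix (foldl absorb Q (quants P))"
proof -
  have "inj (\<lambda>(Q, P). pr (code_prefix Q) (code_prefix P))"
    using inj_code_prefix by (auto simp: inj_def)
  from tabulate_eq[OF this, of _ "(Q, P)"] show ?thesis
    by (simp add: absorb_code_def)
qed

lemma remaining_code:
  "remaining_code (code_prefix Q) (of_bool a) (of_bool b) =
    (case remaining Q (\<lambda>v. case v of Y1 \<Rightarrow> a | Y2 \<Rightarrow> b) of None \<Rightarrow> 0 | Some P \<Rightarrow> Suc (code_prefix P))"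
proof -
  have "inj (\<lambda>(Q, a, b). pr (code_prefix Q) (pr (of_bool a) (of_bool b)))"
    using inj_code_prefix by (auto simp: inj_def of_bool_def split: if_splits)
  from tabulate_eq[OF this, of _ "(Q, a, b)"] show ?thesis
    by (simp add: remaining_code_def)
qed

lemma zero_if_code: "zero_if_code v (code_prefix Q) (code_tm t) = code_tm (zero_if Q v t)"
  using code_tm_eq_Y[of t v]
  by (simp add: zero_if_code_def zeroed_code_def tabulate_eq inj_code_prefix zero_if_def tm_zero_def
      del: code_tm.simps)

lemma code_Strat:
  "code_sfm (Strat t1 t2 \<chi>) = pr 5 (pr (code_tm t1) (pr (code_tm t2) (code_pfm \<chi>)))"
  by (simp add: pr_def)

lemma code_Pre: "code_sfm (Pre P \<phi>) = pr 6 (pr (code_prefix P) (code_sfm \<phi>))"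
  by (simp add: pr_def)

lemma place_elim_code:
  "place_elim_code (code_prefix Q) (code_tm t1) (code_tm t2) (code_pfm \<chi>) =
    code_sfm (place_elim Q t1 t2 \<chi>)"
proof -
  have h: "(\<lambda>v. has_yvar v t1 t2) = (\<lambda>v. case v of Y1 \<Rightarrow> t1 = Y Y1 | Y2 \<Rightarrow> t2 = Y Y2)"
    by (simp add: fun_eq_iff has_yvar_def)
  show ?thesis
    unfolding place_elim_code_def place_elim_def code_tm_eq_Y h of_bool_def[symmetric] remaining_code
      zero_if_code
    by (simp add: Let_def code_Strat code_Pre split: option.split del: code_sfm.simps)
qed

lemma computable_dual_code [computable_intros]:
  "computable k a \<Longrightarrow> computable k (\<lambda>xs. dual_code (a xs))"
  unfolding dual_code_def by (intro computable_tabulate finite_qprefix)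

lemma computable_absorb_code [computable_intros]:
  "computable k a \<Longrightarrow> computable k b \<Longrightarrow> computable k (\<lambda>xs. absorb_code (a xs) (b xs))"
  unfolding absorb_code_def
  by (intro computable_tabulate computable_intros finite_Prod_UNIV finite_qprefix)

lemma computable_remaining_code [computable_intros]:
  "computable k a \<Longrightarrow> computable k b \<Longrightarrow> computable k c \<Longrightarrow>
    computable k (\<lambda>xs. remaining_code (a xs) (b xs) (c xs))"
  unfolding remaining_code_def
  by (intro computable_tabulate computable_intros finite_Prod_UNIV finite_qprefix finite_UNIV)

lemma computable_zero_if_code [computable_intros]:
  assumes "computable k a" "computable k b"
  shows "computable k (\<lambda>xs. zero_if_code v (a xs) (b xs))"
  unfolding zero_if_code_def zeroed_code_def
  using assms by (intro computable_intros computable_tabulate finite_qprefix)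

lemma computable_place_elim_code [computable_intros]:
  assumes "computable k a" "computable k b" "computable k c" "computable k d"
  shows "computable k (\<lambda>xs. place_elim_code (a xs) (b xs) (c xs) (d xs))"
  unfolding place_elim_code_def Let_def using assms by (intro computable_intros)

text \<open>\<open>x\<close> packs formula code \<open>n\<close> and prefix code \<open>q\<close>.
  State and path formulas have disjoint tags, so one function serves both; the last branch treats
  \<open>And\<close>, \<open>Or\<close> and \<open>Until\<close>.\<close>

definition np_step :: "nat \<Rightarrow> nat \<Rightarrow> nat" where
  "np_step x T =
    (let n = x div 155; q = x mod 155; t = p1 n; b = p2 n; val = \<lambda>m q. entry T x (155 * m + q)
     in if t = 0 then n else if t = 1 then n
        else if t = 2 then pr 2 (val b (dual_code q))
        else if t = 5 then place_elim_code q (p1 b) (p1 (p2 b)) (val (p2 (p2 b)) q)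
        else if t = 6 then val (p2 b) (absorb_code q (p1 b))
        else if t = 7 then pr 7 (val b q)
        else if t = 8 then pr 8 (val b q)
        else pr t (pr (val (p1 b) q) (val (p2 b) q)))"

lemma computable_np_step: "computable 2 (\<lambda>xs. np_step (xs ! 0) (xs ! 1))"
  unfolding np_step_def Let_def by (intro computable_intros; simp)

text \<open>Recursive calls may raise the prefix code, but it stays below the base, so a smaller
  formula code makes the packed argument smaller.\<close>

lemma np_entry:
  assumes "m < n"
  shows "entry (table H (155 * n + code_prefix Q)) (155 * n + code_prefix Q) (155 * m + code_prefix Q')
    = cov H (155 * m + code_prefix Q')"
  using assms code_prefix_less[of Q'] by (intro entry_table) linarith

lemma np_code:
  "cov np_step (155 * code_sfm \<phi> + code_prefix Q) = code_sfm (np Q \<phi>)"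
  "cov np_step (155 * code_pfm \<chi> + code_prefix Q) = code_pfm (pnp Q \<chi>)"
proof (induction \<phi> and \<chi> arbitrary: Q and Q)
qed (simp_all add: cov_def[of np_step "_ + _"] np_step_def Let_def code_prefix_less
   np_entry less_pr le_pr1 le_pr2 dual_code absorb_code place_elim_code flip: pr_def)

text \<open>For tag 6, the inner recursion \<open>cov np_step\<close> runs on the already normalised
  scope, packed with the prefix.\<close>

definition nf_step :: "nat \<Rightarrow> nat \<Rightarrow> nat" where
  "nf_step n T =
    (let t = p1 n; b = p2 n; val = entry T n
     in if t = 0 then n else if t = 1 then n
        else if t = 2 then pr 2 (val b)
        else if t = 5 then pr 5 (pr (p1 b) (pr (p1 (p2 b)) (val (p2 (p2 b)))))
        else if t = 6 then cov np_step (155 * val (p2 b) + p1 b)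
        else if t = 7 then pr 7 (val b)
        else if t = 8 then pr 8 (val b)
        else pr t (pr (val (p1 b)) (val (p2 b))))"

lemma computable_nf_step: "computable 2 (\<lambda>xs. nf_step (xs ! 0) (xs ! 1))"
  unfolding nf_step_def Let_def
  by (intro computable_intros computable_cov[OF computable_np_step]; simp)

text \<open>Well-formedness enters through \<open>nf_Pre\<close>, which replaces \<open>pqe\<close>
  after \<open>push\<close> by \<open>np\<close>.\<close>

lemma nf_code:
  "wf_sfm \<phi> \<Longrightarrow> cov nf_step (code_sfm \<phi>) = code_sfm (nf \<phi>)"
  "wf_pfm \<chi> \<Longrightarrow> cov nf_step (code_pfm \<chi>) = code_pfm (pnf \<chi>)"
proof (induction \<phi> and \<chi>)
qed (simp_all add: cov_def[of nf_step] nf_step_def Let_def nf_Pre np_code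
   entry_table less_pr le_pr1 le_pr2 del: nf.simps(7) flip: pr_def)

lemma computable_nf: "computable_on L_HDMAS nf"
proof -
  have "computable 1 (\<lambda>xs. cov nf_step (xs ! 0))"
    by (intro computable_cov[OF computable_nf_step] computable_intros) simp
  then show ?thesis
    by (auto simp: computable_def computable_on_def L_HDMAS_def nf_code)
qed

theorem theorem2:
  shows "(\<forall>\<phi> \<in> L_HDMAS. nf \<phi> \<in> L0) \<and>
         (\<forall>\<phi> \<in> L_HDMAS. fin_equiv TYPE('s) (nf \<phi>) \<phi>) \<and>
         (computable_on L_HDMAS nf \<and>
          (\<exists>a b. \<forall>\<phi> \<in> L_HDMAS. slen (nf \<phi>) \<le> a * slen \<phi> + b))"
proof (intro conjI ballI)
  fix \<phi> assume "\<phi> \<in> L_HDMAS"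
  then have wf: "wf_sfm \<phi>" by (simp add: L_HDMAS_def)
  show "nf \<phi> \<in> L0"
    using nf_props[OF wf] by (simp add: normal_L0)
  show "fin_equiv TYPE('s) (nf \<phi>) \<phi>"
    unfolding fin_equiv_def by (auto simp: sat_nf wf)
next
  show "computable_on L_HDMAS nf" by (rule computable_nf)
  have "\<forall>\<phi> \<in> L_HDMAS. slen (nf \<phi>) \<le> 3 * slen \<phi> + 0"
    by (simp add: L_HDMAS_def slen_nf)
  then show "\<exists>a b. \<forall>\<phi> \<in> L_HDMAS. slen (nf \<phi>) \<le> a * slen \<phi> + b"
    by (intro exI)
qed

end
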